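(* Let $A_k(s;\alpha_1,\dots,\alpha_{2k})$ be the Euler product, built from local factors $\mathcal L_p$, that is defined in the context. If $\mathcal L_p(x)=(1-\gamma_p x)^{-1}$ with $|\gamma_p|=0$ when $p\mid N$ and $|\gamma_p|=1$ otherwise, then $$A_k(s;\alpha_1,\dots,\alpha_{2k})= \prod_{p\nmid N}\ \sum_{m=1}^k\ \prod_{i\neq m}\frac{\prod_{j=1}^k \left(1-\frac{1}{p^{2s+\alpha_j-\alpha_{k+i}}}\right)}{1-p^{\alpha_{k+i}-\alpha_{k+m}}}\ \times\ \prod_{p|N} \prod_{i=1}^k\prod_{j=1}^k\left(1-\frac{1}{p^{2s +\alpha_i-\alpha_{k+j}}}\right).$$ In particular, if $\mathcal L(s)=L(s,\chi)$ with $\chi$ a Dirichlet character of conductor $N$, where the Riemann zeta-function is the case $N=1$, then $$A_1(s;\alpha_1, \alpha_2)=\prod_{p|N}\left(1-\frac{1}{p^{2s +\alpha_1-\alpha_{2}}}\right),$$ $$A_2(s;\alpha_1, \alpha_2,\alpha_3, \alpha_4)=\zeta(4s+\alpha_1+\alpha_2-\alpha_3-\alpha_4)^{-1}\prod_{p|N}\prod_{i=1}^2\prod_{j=1}^2\left(1-\frac{1}{p^{2s +\alpha_i-\alpha_{2+j}}}\right),$$ and, writing $\Sigma=\sum_{i=1}^3(\alpha_i-\alpha_{3+i})$, $$\begin{aligned}A_3(s;\alpha_1,\dots,\alpha_6)=\prod_{p\nmid N}\Bigl(&1-p^{-\Sigma}\,(p^{\alpha_1}+p^{\alpha_2}+p^{\alpha_3})(p^{-\alpha_4}+p^{-\alpha_5}+p^{-\alpha_6})\,p^{-4s}\\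 &+p^{-\Sigma}\bigl[(p^{\alpha_1}+p^{\alpha_2}+p^{\alpha_3})(p^{-\alpha_1}+p^{-\alpha_2}+p^{-\alpha_3})\\ &\qquad\quad+(p^{\alpha_4}+p^{\alpha_5}+p^{\alpha_6})(p^{-\alpha_4}+p^{-\alpha_5}+p^{-\alpha_6})-2\bigr]p^{-6s}\\ &-p^{-\Sigma}(p^{-\alpha_1}+p^{-\alpha_2}+p^{-\alpha_3})(p^{\alpha_4}+p^{\alpha_5}+p^{\alpha_6})\,p^{-8s}+p^{-2\Sigma}p^{-12s}\Bigr)\\ &\times\prod_{p|N}\prod_{i=1}^3\prod_{j=1}^3\left(1-\frac{1}{p^{2s+\alpha_i-\alpha_{3+j}}}\right).\end{aligned}$$
   Context: Here $k\ge1$ and $N\ge1$ are integers, $s,\alpha_1,\dots,\alpha_{2k}$ are complex variables, products over $p$ are over primes, and $e(\theta)=e^{2\pi i\theta}$. For an $L$-function $\mathcal L(s)=\prod_p\mathcal L_p(p^{-s})$ with local factors $\mathcal L_p$, and with $\overline{\mathcal L_p}(x)=\overline{\mathcal L_p(\overline{x})}$, one defines $$A_k(s;\alpha_1,\dots,\alpha_{2k})=\prod_p B_p(s;\alpha_1,\dots,\alpha_{2k})\prod_{i=1}^k\prod_{j=1}^k\left(1-\frac{1}{p^{2s+\alpha_i-\alpha_{k+j}}}\right),$$ $$B_p(s;\alpha_1,\dots,\alpha_{2k})=\int_0^1\prod_{j=1}^k\mathcal L_p\left(\frac{e(\theta)}{p^{s+\alpha_j}}\right)\overline{\mathcal L_p}\left(\frac{e(-\theta)}{p^{s-\alpha_{k+j}}}\right)d\theta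 .$$ In $\prod_{i\ne m}$ the index $i$ runs over $1\le i\le k$, $i\neq m$.
   Formalization: With w=4s+α1+α2-α3-α4, the A_2 formula gets the missing factor ∏_{p|N}(1-p^{-w})^{-1} (as printed it fails for N>1); Re(s+α_j)>0 and Re(s-α_{k+j})>0 are assumed, as are absolute convergence of A_k (proved for k=1) and, in the general formula, nonzero denominators. *)

theory Defs
  imports
    "HOL-Analysis.Analysis"
    "HOL-Computational_Algebra.Primes"
    "HOL-Number_Theory.Cong"
begin

abbreviation powc :: "nat \<Rightarrow> complex \<Rightarrow> complex" (infixr \<open>powc\<close> 80) where
  "p powc z \<equiv> of_nat p powr z"

definition e :: "real \<Rightarrow> complex" where
  "e \<theta> = exp (2 * of_real pi * \<i> * of_real \<theta>)"

definition conj_fun :: "(complex \<Rightarrow> complex) \<Rightarrow> complex \<Rightarrow> complex" where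
  "conj_fun f x = cnj (f (cnj x))"

(* An infinite product over the primes satisfying P is the product of this sequence,
   in which every other index contributes the factor 1. *)
definition over_primes :: "(nat \<Rightarrow> bool) \<Rightarrow> (nat \<Rightarrow> complex) \<Rightarrow> nat \<Rightarrow> complex" where
  "over_primes P f p = (if prime p \<and> P p then f p else 1)"

(* The shifts alpha_1, ..., alpha_2k are the values of a function at the indices 1, ..., 2k;
   its other values are never used.  L p is the local factor at the prime p. *)
definition B_local ::
    "nat \<Rightarrow> (nat \<Rightarrow> complex \<Rightarrow> complex) \<Rightarrow> complex \<Rightarrow> (nat \<Rightarrow> complex) \<Rightarrow> nat \<Rightarrow> complex" where
  "B_local k L s \<alpha> p =
     integral {0..1} (\<lambda>\<theta>. \<Prod>j=1..k.
       L p (e \<theta> / p powc (s + \<alpha> j)) * conj_fun (L p) (e (- \<theta>) / p powc (s - \<alpha> (k + j))))"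

definition A_local ::
    "nat \<Rightarrow> (nat \<Rightarrow> complex \<Rightarrow> complex) \<Rightarrow> complex \<Rightarrow> (nat \<Rightarrow> complex) \<Rightarrow> nat \<Rightarrow> complex" where
  "A_local k L s \<alpha> p =
     B_local k L s \<alpha> p * (\<Prod>i=1..k. \<Prod>j=1..k. 1 - 1 / p powc (2 * s + \<alpha> i - \<alpha> (k + j)))"

definition A_converges ::
    "nat \<Rightarrow> (nat \<Rightarrow> complex \<Rightarrow> complex) \<Rightarrow> complex \<Rightarrow> (nat \<Rightarrow> complex) \<Rightarrow> bool" where
  "A_converges k L s \<alpha> \<longleftrightarrow> abs_convergent_prod (over_primes (\<lambda>_. True) (A_local k L s \<alpha>))"

(* Meaningful as an Euler product where A_converges holds. *)
definition A ::
    "nat \<Rightarrow> (nat \<Rightarrow> complex \<Rightarrow> complex) \<Rightarrow> complex \<Rightarrow> (nat \<Rightarrow> complex) \<Rightarrow> complex" where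
  "A k L s \<alpha> = prodinf (over_primes (\<lambda>_. True) (A_local k L s \<alpha>))"

(* The arguments of the local factors in B_local have modulus p^(-Re(s + alpha_j)) and
   p^(-Re(s - alpha_(k+j))).  The condition says that these are less than 1, i.e. that the
   power series of a local factor 1 / (1 - gamma x) with |gamma| = 1 converges there. *)
definition local_domain :: "nat \<Rightarrow> complex \<Rightarrow> (nat \<Rightarrow> complex) \<Rightarrow> bool" where
  "local_domain k s \<alpha> \<longleftrightarrow> (\<forall>j\<in>{1..k}. 0 < Re (s + \<alpha> j) \<and> 0 < Re (s - \<alpha> (k + j)))"

definition dirichlet_character :: "nat \<Rightarrow> (nat \<Rightarrow> complex) \<Rightarrow> bool" where
  "dirichlet_character N \<psi> \<longleftrightarrow>
     \<psi> 1 = 1 \<and> (\<forall>m n. \<psi> (m * n) = \<psi> m * \<psi> n) \<and> (\<forall>n. \<psi> (n + N) = \<psi> n) \<and>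
     (\<forall>n. \<psi> n = 0 \<longleftrightarrow> \<not> coprime n N)"

(* The least d for which the character modulo N is induced from modulus d. *)
definition conductor :: "nat \<Rightarrow> (nat \<Rightarrow> complex) \<Rightarrow> nat" where
  "conductor N \<psi> =
     (LEAST d. d dvd N \<and> (\<forall>n. coprime n N \<and> [n = 1] (mod d) \<longrightarrow> \<psi> n = 1))"

(* The local factor at p of L(s,psi), that is, of the Euler product
   of 1 / (1 - psi(p) p^(-s)). *)
definition dirichlet_L_local :: "(nat \<Rightarrow> complex) \<Rightarrow> nat \<Rightarrow> complex \<Rightarrow> complex" where
  "dirichlet_L_local \<psi> p x = 1 / (1 - \<psi> p * x)"

(* The Riemann zeta function on Re w > 1; no continuation is included. *)
definition zeta :: "complex \<Rightarrow> complex" where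
  "zeta w = (\<Sum>n. 1 / (Suc n) powc w)"

end

theory Submission
  imports Defs "HOL-Complex_Analysis.Complex_Analysis" "HOL-Number_Theory.Residues"
begin

text \<open>
  At a prime \<open>p\<close> not dividing \<open>N\<close> put \<open>x\<^sub>j = \<gamma> / p\<^bsup>s + \<alpha>\<^sub>j\<^esup>\<close> and let \<open>y\<^sub>j\<close> be the conjugate of
  \<open>\<gamma>\<close> divided by \<open>p\<^bsup>s - \<alpha>\<^sub>k\<^sub>+\<^sub>j\<^esup>\<close>, so that \<open>\<gamma>\<close> cancels from every \<open>x\<^sub>i y\<^sub>j\<close>.  Expanding
  \<open>\<Prod> 1 / (1 - y\<^sub>j e(-\<theta>))\<close> into partial fractions reduces \<open>B\<^sub>p\<close> to Cauchy's integral formula on the unit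
  circle, which gives the sum over \<open>m\<close> when the \<open>y\<^sub>j\<close> are distinct.  For \<open>k = 2\<close> and \<open>k = 3\<close> the sum is
  a polynomial in the \<open>x\<^sub>j\<close> and \<open>y\<^sub>j\<close>, and by continuity the restriction on the \<open>y\<^sub>j\<close> disappears.
  For \<open>k = 2\<close> absolute convergence of \<open>\<Prod> (1 - p\<^bsup>-w\<^esup>)\<close> forces \<open>Re w > 1\<close>, because
  \<open>\<Sum> 1/p\<close> diverges, and the product is then evaluated by the Euler product of \<open>\<zeta>\<close>.
\<close>

section \<open>Integrals over the unit circle\<close>

lemma norm_e [simp]: "norm (e \<theta>) = 1"
  by (simp add: e_def norm_exp_eq_Re)

lemma e_minus: "e (- \<theta>) = inverse (e \<theta>)"
  by (simp add: e_def exp_minus)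

lemma e_nonzero [simp]: "e \<theta> \<noteq> 0"
  by (simp add: e_def)

lemma continuous_on_e [continuous_intros]:
  "continuous_on S f \<Longrightarrow> continuous_on S (\<lambda>x. e (f x))"
  unfolding e_def by (intro continuous_intros)

lemma one_minus_nonzero:
  fixes z :: complex
  shows "norm z < 1 \<Longrightarrow> 1 - z \<noteq> 0"
  by auto

text \<open>With \<open>u = e \<theta>\<close> one has \<open>du = 2 pi i u d\<theta>\<close> and
  \<open>u / (u - y) = 1 / (1 - y * e (- \<theta>))\<close>, so this is Cauchy's formula at
  \<open>y\<close> on the unit circle, parametrized over \<open>{0..1}\<close>.\<close>

lemma has_integral_circle_Cauchy:
  assumes g: "g holomorphic_on cball 0 1" and y: "norm y < 1"
  shows "((\<lambda>\<theta>. g (e \<theta>) * (1 / (1 - y * e (- \<theta>)))) has_integral g y) {0..1}"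
proof -
  define c where "c = 2 * of_real pi * \<i>"
  have c: "c \<noteq> 0" by (simp add: c_def)
  have path: "circlepath 0 1 x = e x" for x
    by (simp add: circlepath e_def mult_ac)
  have vd: "vector_derivative (circlepath 0 1) (at x) = 2 * of_real pi * \<i> * e x" for x
    by (simp add: vector_derivative_circlepath e_def mult_ac)
  have "((\<lambda>u. g u / (u - y)) has_contour_integral (2 * of_real pi * \<i> * g y)) (circlepath 0 1)"
    using assms by (intro Cauchy_integral_circlepath_simple) auto
  then have "((\<lambda>x. g (e x) / (e x - y) * (2 * of_real pi * \<i> * e x)) has_integral
      (2 * of_real pi * \<i> * g y)) {0..1}"
    by (simp add: has_contour_integral path vd)
  then have "((\<lambda>x. 1 / c * (g (e x) / (e x - y) * (c * e x))) has_integral 1 / c * (c * g y)) {0..1}"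
    unfolding c_def by (rule has_integral_mult_right)
  moreover have "1 / c * (c * g y) = g y"
    using c by simp
  moreover have "1 / c * (g (e x) / (e x - y) * (c * e x)) = g (e x) * (1 / (1 - y * e (- x)))" for x
  proof -
    have "e x - y \<noteq> 0" using y norm_e[of x] by auto
    moreover have "1 - y * e (- x) \<noteq> 0"
      using y by (intro one_minus_nonzero) (simp add: norm_mult)
    ultimately show ?thesis
      using c by (simp add: e_minus divide_simps)
  qed
  ultimately show ?thesis by simp
qed

text \<open>With \<open>w\<close> cleared from the denominators this is Lagrange interpolation of the constant \<open>1\<close>
  at the points \<open>1 / y n\<close>.\<close>

lemma prod_inverse_partial_fractions:
  fixes y :: "'i \<Rightarrow> complex"
  assumes I: "finite I" "I \<noteq> {}" and inj: "inj_on y I" and nz: "\<And>i. i \<in> I \<Longrightarrow> y i \<noteq> 0"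
    and w: "\<And>i. i \<in> I \<Longrightarrow> 1 - y i * w \<noteq> 0"
  shows "(\<Prod>i\<in>I. 1 / (1 - y i * w)) =
    (\<Sum>m\<in>I. (\<Prod>i\<in>I - {m}. 1 / (1 - y i / y m)) * (1 / (1 - y m * w)))"
proof -
  \<comment> \<open>\<open>q\<close> is the interpolating polynomial minus its target
    \<open>1\<close>. Its degree is below \<open>card I\<close>, yet the \<open>card I\<close>
    distinct points \<open>1 / y n\<close> are roots, so it vanishes.\<close>
  define q where "q = (\<Sum>m\<in>I. Polynomial.smult (\<Prod>i\<in>I - {m}. 1 / (1 - y i / y m)) (\<Prod>i\<in>I - {m}. [:1, - y i:])) - 1"
  have polyq: "poly q z = (\<Sum>m\<in>I. (\<Prod>i\<in>I - {m}. 1 / (1 - y i / y m)) * (\<Prod>i\<in>I - {m}. 1 - y i * z)) - 1" for z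
    by (simp add: q_def poly_sum poly_prod mult.commute)
  have root: "poly q (1 / y n) = 0" if n: "n \<in> I" for n
  proof -
    \<comment> \<open>A summand with \<open>m \<noteq> n\<close> keeps the factor of index
      \<open>n\<close>, which is zero at \<open>1 / y n\<close>.\<close>
    have "(\<Prod>i\<in>I - {m}. 1 - y i * (1 / y n)) = 0" if "m \<in> I - {n}" for m
      using that n nz I by (subst prod_zero_iff) auto
    then have "(\<Sum>m\<in>I. (\<Prod>i\<in>I - {m}. 1 / (1 - y i / y m)) * (\<Prod>i\<in>I - {m}. 1 - y i * (1 / y n)))
      = (\<Sum>m\<in>{n}. (\<Prod>i\<in>I - {m}. 1 / (1 - y i / y m)) * (\<Prod>i\<in>I - {m}. 1 - y i * (1 / y n)))"
      using I n by (intro sum.mono_neutral_right) auto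
    also have "\<dots> = (\<Prod>i\<in>I - {n}. 1 / (1 - y i / y n) * (1 - y i / y n))"
      unfolding prod.distrib by simp
    also have "\<dots> = (\<Prod>i\<in>I - {n}. 1)"
    proof (rule prod.cong[OF refl])
      fix i assume "i \<in> I - {n}"
      then have "y i \<noteq> y n" using inj n by (auto dest: inj_onD)
      then show "1 / (1 - y i / y n) * (1 - y i / y n) = 1"
        using nz[OF n] by simp
    qed
    finally show ?thesis by (simp add: polyq)
  qed
  have q0: "q = 0"
  proof (rule ccontr)
    assume "q \<noteq> 0"
    have "degree q \<le> card I - 1" unfolding q_def
    proof (intro degree_diff_le degree_sum_le)
      fix m assume m: "m \<in> I"
      have "degree (\<Prod>i\<in>I - {m}. [:1, - y i:]) \<le> (\<Sum>i\<in>I - {m}. degree [:1, - y i:])"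
        using I by (intro degree_prod_sum_le[unfolded o_def]) auto
      also have "\<dots> \<le> (\<Sum>i\<in>I - {m}. 1)"
        by (intro sum_mono) auto
      finally have "degree (\<Prod>i\<in>I - {m}. [:1, - y i:]) \<le> card I - 1"
        using m I by simp
      then show "degree (Polynomial.smult (\<Prod>i\<in>I - {m}. 1 / (1 - y i / y m)) (\<Prod>i\<in>I - {m}. [:1, - y i:])) \<le> card I - 1"
        using degree_smult_le le_trans by blast
    qed (use I in auto)
    moreover have "card I \<le> card {z. poly q z = 0}"
    proof -
      have "inj_on (\<lambda>n. 1 / y n) I"
        using inj by (auto simp: inj_on_def)
      moreover have "(\<lambda>n. 1 / y n) ` I \<subseteq> {z. poly q z = 0}"
        using root by auto
      ultimately show ?thesis
        using poly_roots_finite[OF \<open>q \<noteq> 0\<close>] by (metis card_image card_mono)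
    qed
    \<comment> \<open>The subtraction in \<open>card I - 1\<close> is truncated; nonemptiness of
      \<open>I\<close> makes the degree bound strictly smaller than the number of roots.\<close>
    moreover have "card I > 0" using I by (simp add: card_gt_0_iff)
    ultimately show False
      using card_poly_roots_bound[OF \<open>q \<noteq> 0\<close>] by linarith
  qed
  let ?P = "\<Prod>i\<in>I. 1 - y i * w"
  have P: "?P \<noteq> 0" using w I by simp
  have "(\<Sum>m\<in>I. (\<Prod>i\<in>I - {m}. 1 / (1 - y i / y m)) * (\<Prod>i\<in>I - {m}. 1 - y i * w)) = 1"
    using polyq[of w] q0 by simp
  then have "1 / ?P = (\<Sum>m\<in>I. (\<Prod>i\<in>I - {m}. 1 / (1 - y i / y m)) * (\<Prod>i\<in>I - {m}. 1 - y i * w)) / ?P"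
    by simp
  also have "\<dots> = (\<Sum>m\<in>I. (\<Prod>i\<in>I - {m}. 1 / (1 - y i / y m)) * (1 / (1 - y m * w)))"
    unfolding sum_divide_distrib
  proof (rule sum.cong[OF refl])
    fix m assume m: "m \<in> I"
    have "?P = (1 - y m * w) * (\<Prod>i\<in>I - {m}. 1 - y i * w)"
      using m I by (simp add: prod.remove)
    moreover have "(\<Prod>i\<in>I - {m}. 1 - y i * w) \<noteq> 0"
      using w I by simp
    ultimately show "(\<Prod>i\<in>I - {m}. 1 / (1 - y i / y m)) * (\<Prod>i\<in>I - {m}. 1 - y i * w) / ?P
      = (\<Prod>i\<in>I - {m}. 1 / (1 - y i / y m)) * (1 / (1 - y m * w))"
      using w[OF m] by simp
  qed
  finally show ?thesis by (simp add: prod_dividef)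
qed

section \<open>The local integral for distinct parameters, and its extension by continuity\<close>

definition circle_integral :: "nat \<Rightarrow> (nat \<Rightarrow> complex) \<Rightarrow> (nat \<Rightarrow> complex) \<Rightarrow> complex" where
  "circle_integral k x y =
     integral {0..1} (\<lambda>\<theta>. \<Prod>j=1..k. 1 / (1 - x j * e \<theta>) * (1 / (1 - y j * e (- \<theta>))))"

text \<open>This is \<open>A_local\<close> at a prime not dividing \<open>N\<close>, freed of the
  prime and the shifts: once \<open>x i * y j\<close> is identified with the inverse power of
  \<open>p\<close>, the double product is the one in \<open>A_local\<close>.\<close>

definition normalized_integral :: "nat \<Rightarrow> (nat \<Rightarrow> complex) \<Rightarrow> (nat \<Rightarrow> complex) \<Rightarrow> complex" where
  "normalized_integral k x y = circle_integral k x y * (\<Prod>i=1..k. \<Prod>j=1..k. 1 - x i * y j)"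

lemma norm_mult_less_one:
  fixes a b :: complex
  shows "norm a < 1 \<Longrightarrow> norm b \<le> 1 \<Longrightarrow> norm (a * b) < 1"
  by (smt (verit) mult_left_le norm_ge_zero norm_mult)

text \<open>The product over the \<open>x j\<close> is a function \<open>g\<close> of
  \<open>e \<theta>\<close> whose poles lie outside the closed unit disc. After the partial fraction
  expansion in \<open>e (- \<theta>)\<close>, Cauchy's formula replaces \<open>e \<theta>\<close> by
  \<open>y m\<close> in the \<open>m\<close>-th term.\<close>

lemma normalized_integral_distinct:
  assumes k: "k \<ge> 1" and x: "\<And>j. j \<in> {1..k} \<Longrightarrow> norm (x j) < 1"
    and y: "\<And>j. j \<in> {1..k} \<Longrightarrow> norm (y j) < 1"
    and inj: "inj_on y {1..k}" and nz: "\<And>j. j \<in> {1..k} \<Longrightarrow> y j \<noteq> 0"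
  shows "normalized_integral k x y =
    (\<Sum>m=1..k. \<Prod>i\<in>{1..k} - {m}. (\<Prod>j=1..k. 1 - x j * y i) / (1 - y i / y m))"
proof -
  define c where "c m = (\<Prod>i\<in>{1..k} - {m}. 1 / (1 - y i / y m))" for m
  define g where "g z = (\<Prod>j=1..k. 1 / (1 - x j * z))" for z
  have g: "g holomorphic_on cball 0 1"
    unfolding g_def using x by (intro holomorphic_intros one_minus_nonzero norm_mult_less_one) auto
  have "((\<lambda>\<theta>. \<Sum>m=1..k. c m * (g (e \<theta>) * (1 / (1 - y m * e (- \<theta>))))) has_integral
      (\<Sum>m=1..k. c m * g (y m))) {0..1}"
    using y by (intro has_integral_sum has_integral_mult_right has_integral_circle_Cauchy[OF g]) auto
  also have "(\<lambda>\<theta>. \<Sum>m=1..k. c m * (g (e \<theta>) * (1 / (1 - y m * e (- \<theta>))))) =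
      (\<lambda>\<theta>. \<Prod>j=1..k. 1 / (1 - x j * e \<theta>) * (1 / (1 - y j * e (- \<theta>))))"
  proof
    fix \<theta>
    have "(\<Prod>j=1..k. 1 / (1 - x j * e \<theta>)) = g (e \<theta>)"
      by (simp add: g_def)
    moreover have "(\<Prod>j=1..k. 1 / (1 - y j * e (- \<theta>))) = (\<Sum>m=1..k. c m * (1 / (1 - y m * e (- \<theta>))))"
      unfolding c_def using k y inj nz
      by (intro prod_inverse_partial_fractions one_minus_nonzero norm_mult_less_one) auto
    ultimately show "(\<Sum>m=1..k. c m * (g (e \<theta>) * (1 / (1 - y m * e (- \<theta>))))) =
      (\<Prod>j=1..k. 1 / (1 - x j * e \<theta>) * (1 / (1 - y j * e (- \<theta>))))"
      by (simp only: prod.distrib sum_distrib_left mult_ac)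
  qed
  finally have "circle_integral k x y = (\<Sum>m=1..k. c m * g (y m))"
    unfolding circle_integral_def by (rule integral_unique)
  \<comment> \<open>The swap makes the index of \<open>y\<close> the outer one. The block belonging
    to \<open>y m\<close> is then the reciprocal of \<open>g (y m)\<close>, so that only the blocks
    with \<open>i \<noteq> m\<close> survive.\<close>
  then have "normalized_integral k x y =
      (\<Sum>m=1..k. c m * g (y m) * (\<Prod>i=1..k. \<Prod>j=1..k. 1 - x j * y i))"
    unfolding normalized_integral_def by (subst prod.swap) (simp add: sum_distrib_right)
  also have "\<dots> = (\<Sum>m=1..k. \<Prod>i\<in>{1..k} - {m}. (\<Prod>j=1..k. 1 - x j * y i) / (1 - y i / y m))"
  proof (rule sum.cong[OF refl])
    fix m assume m: "m \<in> {1..k}"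
    have "(\<Prod>i=1..k. \<Prod>j=1..k. 1 - x j * y i) =
        (\<Prod>j=1..k. 1 - x j * y m) * (\<Prod>i\<in>{1..k} - {m}. \<Prod>j=1..k. 1 - x j * y i)"
      by (rule prod.remove[OF _ m]) simp
    moreover have "g (y m) * (\<Prod>j=1..k. 1 - x j * y m) = 1"
    proof -
      have "1 / (1 - x j * y m) * (1 - x j * y m) = 1" if "j \<in> {1..k}" for j
        using one_minus_nonzero[OF norm_mult_less_one[OF x[OF that], of "y m"]] y[OF m] by simp
      then show ?thesis
        unfolding g_def prod.distrib[symmetric] by (intro prod.neutral) auto
    qed
    ultimately have "c m * g (y m) * (\<Prod>i=1..k. \<Prod>j=1..k. 1 - x j * y i) =
        c m * (\<Prod>i\<in>{1..k} - {m}. \<Prod>j=1..k. 1 - x j * y i)"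
      by (simp add: mult.assoc)
    then show "c m * g (y m) * (\<Prod>i=1..k. \<Prod>j=1..k. 1 - x j * y i) =
        (\<Prod>i\<in>{1..k} - {m}. (\<Prod>j=1..k. 1 - x j * y i) / (1 - y i / y m))"
      by (simp add: c_def prod_dividef)
  qed
  finally show ?thesis .
qed

text \<open>Moving \<open>y i\<close> to \<open>y i + i t\<close> makes the parameters distinct and nonzero for small \<open>t \<noteq> 0\<close>,
  so by continuity a formula that holds for such parameters holds without restriction.\<close>

lemma normalized_integral_eqI:
  assumes x: "\<And>j. j \<in> {1..k} \<Longrightarrow> norm (x j) < 1" and y: "\<And>j. j \<in> {1..k} \<Longrightarrow> norm (y j) < 1"
    and cont: "continuous_on UNIV (\<lambda>t. G (\<lambda>i. y i + of_real (t * real i)))"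
    and eq: "\<And>y. (\<And>j. j \<in> {1..k} \<Longrightarrow> norm (y j) < 1) \<Longrightarrow> inj_on y {1..k} \<Longrightarrow>
       (\<And>j. j \<in> {1..k} \<Longrightarrow> y j \<noteq> 0) \<Longrightarrow> normalized_integral k x y = G y"
  shows "normalized_integral k x y = G y"
proof -
  define z where "z t i = y i + of_real (t * real i)" for t i
  have zlim: "((\<lambda>t. z t i) \<longlongrightarrow> y i) (at 0)" for i
    unfolding z_def by (auto intro!: tendsto_eq_intros)
  have "eventually (\<lambda>t. \<forall>j\<in>{1..k}. norm (z t j) < 1) (at 0)"
    using y by (intro eventually_ball_finite ballI order_tendstoD(2)[OF tendsto_norm[OF zlim]]) auto
  then obtain d where d: "d > 0" "\<And>t j. t \<noteq> 0 \<Longrightarrow> norm t < d \<Longrightarrow> j \<in> {1..k} \<Longrightarrow> norm (z t j) < 1"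
    unfolding eventually_at by (auto simp: dist_norm)
  \<comment> \<open>The radius \<open>d\<close> comes from a punctured neighbourhood, so
    \<open>t = 0\<close>, where \<open>z 0 j = y j\<close>, is treated separately.\<close>
  have z1: "norm (z t j) < 1" if "t \<in> ball 0 d" "j \<in> {1..k}" for t j
    using d(2)[of t j] that y[of j] by (cases "t = 0") (auto simp: z_def)
  have z1': "norm (y j + of_real t * of_nat j) < 1" if "\<bar>t\<bar> < d" "Suc 0 \<le> j" "j \<le> k" for t j
    using z1[of t j] that by (simp add: z_def)
  \<comment> \<open>On this ball no denominator vanishes, so the integrand is jointly continuous in
    \<open>t\<close> and \<open>\<theta>\<close>; hence the integral is continuous in
    \<open>t\<close>, in particular at \<open>0\<close>.\<close>
  have "continuous_on (ball 0 d) (\<lambda>t. integral (cbox 0 1)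
      (\<lambda>\<theta>. \<Prod>j=1..k. 1 / (1 - x j * e \<theta>) * (1 / (1 - z t j * e (- \<theta>)))))"
  proof (rule integral_continuous_on_param)
    show "continuous_on (ball 0 d \<times> cbox 0 1)
      (\<lambda>(t, \<theta>). \<Prod>j=1..k. 1 / (1 - x j * e \<theta>) * (1 / (1 - z t j * e (- \<theta>))))"
      unfolding case_prod_beta
      by (intro continuous_intros one_minus_nonzero norm_mult_less_one ballI)
        (auto simp: z_def x intro!: continuous_intros z1')
  qed
  then have "continuous_on (ball 0 d) (\<lambda>t. normalized_integral k x (z t))"
    unfolding normalized_integral_def circle_integral_def
    by (intro continuous_intros) (auto simp: z_def intro!: continuous_intros)
  then have "isCont (\<lambda>t. normalized_integral k x (z t)) 0"
    using d(1) by (simp add: continuous_on_eq_continuous_at)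
  then have l1: "((\<lambda>t. normalized_integral k x (z t)) \<longlongrightarrow> normalized_integral k x (z 0)) (at 0)"
    by (simp add: isCont_def)
  have "isCont (\<lambda>t. G (\<lambda>i. y i + of_real (t * real i))) 0"
    by (rule continuous_on_interior[OF cont]) simp
  then have l2: "((\<lambda>t. G (z t)) \<longlongrightarrow> G (z 0)) (at 0)"
    unfolding isCont_def z_def[abs_def] .
  \<comment> \<open>Solving \<open>z t i = z t j\<close> and \<open>z t i = 0\<close> for the real
    number \<open>t\<close> puts every bad value into this finite set. Pairs with
    \<open>i = j\<close> give \<open>0 / 0 = 0\<close>, a value that a punctured neighbourhood of
    \<open>0\<close> avoids.\<close>
  define B where "B = (\<lambda>(i, j). Re ((y i - y j) / of_real (real j - real i))) ` ({1..k} \<times> {1..k})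
      \<union> (\<lambda>i. - Re (y i) / real i) ` {1..k}"
  have B: "finite B" by (simp add: B_def)
  have "eventually (\<lambda>t. t \<notin> B) (at 0)"
    using B islimpt_finite[OF B] by (simp add: islimpt_iff_eventually)
  then have ev: "eventually (\<lambda>t. normalized_integral k x (z t) = G (z t)) (at 0)"
    using eventually_at_ball[OF d(1), of 0 UNIV]
  proof eventually_elim
    case (elim t)
    show ?case
    proof (rule eq)
      show "inj_on (z t) {1..k}"
      proof (rule inj_onI, rule ccontr)
        fix i j assume ij: "i \<in> {1..k}" "j \<in> {1..k}" "z t i = z t j" "i \<noteq> j"
        then have "y i - y j = of_real t * of_real (real j - real i)"
          by (simp add: z_def algebra_simps)
        then have "of_real t = (y i - y j) / of_real (real j - real i)"
          using ij(4) by simp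
        then have "t = Re ((y i - y j) / of_real (real j - real i))"
          by (metis Re_complex_of_real)
        then show False using elim(1) ij(1,2) by (auto simp: B_def)
      qed
      show "z t j \<noteq> 0" if "j \<in> {1..k}" for j
      proof
        assume "z t j = 0"
        then have "Re (y j) + t * real j = 0"
          by (simp add: z_def complex_eq_iff)
        then have "t = - Re (y j) / real j" using that by (simp add: field_simps)
        then show False using elim(1) that by (auto simp: B_def)
      qed
    qed (use z1 elim in auto)
  qed
  have "((\<lambda>t. G (z t)) \<longlongrightarrow> normalized_integral k x (z 0)) (at 0)"
    using l1 ev by (rule Lim_transform_eventually)
  then have "normalized_integral k x (z 0) = G (z 0)"
    using l2 by (intro tendsto_unique[of "at (0::real)"]) auto
  moreover have "z 0 = y" by (rule ext) (simp add: z_def)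
  ultimately show ?thesis by simp
qed

section \<open>Polynomial closed forms for \<open>k = 2\<close> and \<open>k = 3\<close>\<close>

lemma divide_one_minus_divide:
  fixes c u v :: "'a::field"
  assumes "v \<noteq> 0" "u \<noteq> v"
  shows "c / (1 - u / v) = c * v / (v - u)"
  using assms by (simp add: field_simps)

text \<open>Over the common denominator \<open>y 1 - y 2\<close> the two terms have an antisymmetric
  numerator, hence a multiple of \<open>y 1 - y 2\<close>. The quotient is a polynomial, which still
  makes sense for \<open>y 1 = y 2\<close>.\<close>

lemma normalized_integral_2:
  assumes x: "\<And>j. j \<in> {1..2} \<Longrightarrow> norm (x j) < 1" and y: "\<And>j. j \<in> {1..2} \<Longrightarrow> norm (y j) < 1"
  shows "normalized_integral 2 x y = 1 - x 1 * x 2 * y 1 * y 2"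
proof (rule normalized_integral_eqI[OF x y])
  show "continuous_on UNIV (\<lambda>t. 1 - x 1 * x 2 * (y 1 + of_real (t * real 1)) * (y 2 + of_real (t * real 2)))"
    by (intro continuous_intros)
next
  fix y :: "nat \<Rightarrow> complex"
  assume y: "\<And>j. j \<in> {1..2} \<Longrightarrow> norm (y j) < 1" and inj: "inj_on y {1..2}"
    and nz: "\<And>j. j \<in> {1..2} \<Longrightarrow> y j \<noteq> 0"
  have sets: "{1..2} = {1, 2::nat}" "{1, 2} - {1} = {2::nat}" "{1, 2} - {2} = {1::nat}" by auto
  have ne: "y 1 \<noteq> y 2" "y 1 \<noteq> 0" "y 2 \<noteq> 0"
    using nz[of 1] nz[of 2] inj_onD[OF inj, of 1 2] by auto
  define P where "P t = (1 - x 1 * t) * (1 - x 2 * t)" for t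
  have "normalized_integral 2 x y = P (y 2) / (1 - y 2 / y 1) + P (y 1) / (1 - y 1 / y 2)"
  proof -
    define T where "T i m = (\<Prod>j=1..2. 1 - x j * y i) / (1 - y i / y m)" for i m
    have T: "T i m = P (y i) / (1 - y i / y m)" for i m
      unfolding T_def sets(1) by (simp add: P_def)
    have "normalized_integral 2 x y = (\<Sum>m=1..2. \<Prod>i\<in>{1..2} - {m}. T i m)"
      unfolding T_def by (rule normalized_integral_distinct[OF _ x y inj nz]) auto
    also have "\<dots> = (\<Prod>i\<in>{1, 2} - {1}. T i 1) + (\<Prod>i\<in>{1, 2} - {2}. T i 2)"
      unfolding sets(1) by simp
    also have "\<dots> = T 2 1 + T 1 2"
      unfolding sets by simp
    finally show ?thesis unfolding T .
  qed
  also have "\<dots> = P (y 2) * y 1 / (y 1 - y 2) + P (y 1) * y 2 / (- (y 1 - y 2))"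
    using divide_one_minus_divide[of "y 1" "y 2"] divide_one_minus_divide[of "y 2" "y 1"] ne by simp
  also have "\<dots> = (P (y 2) * y 1 - P (y 1) * y 2) / (y 1 - y 2)"
    by (simp only: minus_divide_right[symmetric] diff_divide_distrib add_uminus_conv_diff)
  also have "P (y 2) * y 1 - P (y 1) * y 2 = (1 - x 1 * x 2 * y 1 * y 2) * (y 1 - y 2)"
    unfolding P_def by (simp add: algebra_simps)
  also have "\<dots> / (y 1 - y 2) = 1 - x 1 * x 2 * y 1 * y 2"
    using ne by (intro nonzero_mult_div_cancel_right) simp
  finally show "normalized_integral 2 x y = 1 - x 1 * x 2 * y 1 * y 2" .
qed

text \<open>The \<open>a\<close>'s and \<open>b\<close>'s are the elementary symmetric polynomials of \<open>x\<close> and of \<open>y\<close>.\<close>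

definition cubic_kernel :: "(nat \<Rightarrow> complex) \<Rightarrow> (nat \<Rightarrow> complex) \<Rightarrow> complex" where
  "cubic_kernel x y =
     (let a1 = x 1 + x 2 + x 3; a2 = x 1 * x 2 + x 1 * x 3 + x 2 * x 3; a3 = x 1 * x 2 * x 3;
          b1 = y 1 + y 2 + y 3; b2 = y 1 * y 2 + y 1 * y 3 + y 2 * y 3; b3 = y 1 * y 2 * y 3
      in 1 - a2 * b2 + (a1 * a2 * b3 + a3 * b1 * b2 - 2 * a3 * b3) - a3 * b3 * a1 * b1 + (a3 * b3)^2)"

text \<open>The left side is the numerator of the sum over \<open>m\<close> for
  \<open>k = 3\<close>, brought over the Vandermonde product of the \<open>y\<close>'s. It is
  antisymmetric in the \<open>y\<close>'s; expanding \<open>P\<close> by its coefficients reduces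
  the division to ten small identities in the \<open>y\<close>'s alone.\<close>

lemma cubic_kernel_Lagrange:
  fixes x1 x2 x3 y1 y2 y3 :: complex
  defines "P \<equiv> \<lambda>t. (1 - x1 * t) * (1 - x2 * t) * (1 - x3 * t)"
  defines "a1 \<equiv> x1 + x2 + x3" and "a2 \<equiv> x1 * x2 + x1 * x3 + x2 * x3" and "a3 \<equiv> x1 * x2 * x3"
    and "b1 \<equiv> y1 + y2 + y3" and "b2 \<equiv> y1 * y2 + y1 * y3 + y2 * y3" and "b3 \<equiv> y1 * y2 * y3"
  shows "y1^2 * (y2 - y3) * P y2 * P y3 - y2^2 * (y1 - y3) * P y1 * P y3 + y3^2 * (y1 - y2) * P y1 * P y2 =
    (1 - a2 * b2 + (a1 * a2 * b3 + a3 * b1 * b2 - 2 * a3 * b3) - a3 * b3 * a1 * b1 + (a3 * b3)^2) *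
      ((y1 - y2) * (y1 - y3) * (y2 - y3))"
proof -
  \<comment> \<open>The coefficients of \<open>P\<close> in ascending order.\<close>
  define c where "c = (!) [1, - a1, a2, - a3]"
  \<comment> \<open>The same numerator with its two values of \<open>P\<close> replaced by an
    \<open>i\<close>-th and a \<open>j\<close>-th power.\<close>
  define M where "M i j = y1^2 * (y2 - y3) * (y2^i * y3^j) - y2^2 * (y1 - y3) * (y1^i * y3^j)
    + y3^2 * (y1 - y2) * (y1^i * y2^j)" for i j
  define V where "V = (y1 - y2) * (y1 - y3) * (y2 - y3)"
  have P: "P t = (\<Sum>i<4. c i * t^i)" for t
    unfolding P_def a1_def a2_def a3_def c_def
    by (simp add: eval_nat_numeral algebra_simps)
  have PP: "d * P u * P v = (\<Sum>i<4. \<Sum>j<4. c i * c j * (d * (u^i * v^j)))" for d u v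
    unfolding P mult.assoc sum_product by (simp add: sum_distrib_left mult_ac)
  have "y1^2 * (y2 - y3) * P y2 * P y3 - y2^2 * (y1 - y3) * P y1 * P y3 + y3^2 * (y1 - y2) * P y1 * P y2 =
      (\<Sum>i<4. \<Sum>j<4. c i * c j * M i j)"
    unfolding PP M_def by (simp only: sum.distrib sum_subtractf distrib_left right_diff_distrib)
  \<comment> \<open>The terms \<open>(i, j)\<close> and \<open>(j, i)\<close> share a coefficient,
    and \<open>M i j + M j i\<close> is antisymmetric, hence a multiple of \<open>V\<close>.\<close>
  also have "\<dots> = M 0 0 - a1 * (M 0 1 + M 1 0) + a2 * (M 0 2 + M 2 0) - a3 * (M 0 3 + M 3 0) + a1^2 * M 1 1
      - a1 * a2 * (M 1 2 + M 2 1) + a1 * a3 * (M 1 3 + M 3 1) + a2^2 * M 2 2 - a2 * a3 * (M 2 3 + M 3 2) + a3^2 * M 3 3"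
    by (simp add: c_def eval_nat_numeral algebra_simps)
  also have "M 0 0 = V" unfolding M_def V_def by (simp add: algebra_simps eval_nat_numeral)
  also have "M 0 1 + M 1 0 = 0" unfolding M_def by (simp add: algebra_simps eval_nat_numeral)
  also have "M 0 2 + M 2 0 = - b2 * V" unfolding M_def V_def b2_def by (simp add: algebra_simps eval_nat_numeral)
  also have "M 0 3 + M 3 0 = (2 * b3 - b1 * b2) * V"
    unfolding M_def V_def b1_def b2_def b3_def by (simp add: algebra_simps eval_nat_numeral)
  also have "M 1 1 = 0" unfolding M_def by (simp add: algebra_simps eval_nat_numeral)
  also have "M 1 2 + M 2 1 = - b3 * V" unfolding M_def V_def b3_def by (simp add: algebra_simps eval_nat_numeral)
  also have "M 1 3 + M 3 1 = - b3 * b1 * V" unfolding M_def V_def b3_def b1_def by (simp add: algebra_simps eval_nat_numeral)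
  also have "M 2 2 = 0" unfolding M_def by (simp add: algebra_simps eval_nat_numeral)
  also have "M 2 3 + M 3 2 = 0" unfolding M_def by (simp add: algebra_simps eval_nat_numeral)
  also have "M 3 3 = b3^2 * V" unfolding M_def V_def b3_def by (simp add: algebra_simps eval_nat_numeral)
  finally show ?thesis
    unfolding V_def[symmetric] by (simp add: algebra_simps power_mult_distrib)
qed

lemma normalized_integral_3:
  assumes x: "\<And>j. j \<in> {1..3} \<Longrightarrow> norm (x j) < 1" and y: "\<And>j. j \<in> {1..3} \<Longrightarrow> norm (y j) < 1"
  shows "normalized_integral 3 x y = cubic_kernel x y"
proof (rule normalized_integral_eqI[OF x y])
  show "continuous_on UNIV (\<lambda>t. cubic_kernel x (\<lambda>i. y i + of_real (t * real i)))"
    unfolding cubic_kernel_def Let_def by (intro continuous_intros)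
next
  fix y :: "nat \<Rightarrow> complex"
  assume y: "\<And>j. j \<in> {1..3} \<Longrightarrow> norm (y j) < 1" and inj: "inj_on y {1..3}"
    and nz: "\<And>j. j \<in> {1..3} \<Longrightarrow> y j \<noteq> 0"
  have sets: "{1..3} = {1, 2, 3::nat}" "{1, 2, 3} - {1} = {2, 3::nat}"
    "{1, 2, 3} - {2} = {1, 3::nat}" "{1, 2, 3} - {3} = {1, 2::nat}" by auto
  have ne: "y 1 \<noteq> y 2" "y 1 \<noteq> y 3" "y 2 \<noteq> y 3" "y 1 \<noteq> 0" "y 2 \<noteq> 0" "y 3 \<noteq> 0"
    using nz[of 1] nz[of 2] nz[of 3] inj_onD[OF inj, of 1 2] inj_onD[OF inj, of 1 3]
      inj_onD[OF inj, of 2 3] by auto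
  define P where "P t = (1 - x 1 * t) * (1 - x 2 * t) * (1 - x 3 * t)" for t
  have "normalized_integral 3 x y =
      P (y 2) / (1 - y 2 / y 1) * (P (y 3) / (1 - y 3 / y 1)) +
      P (y 1) / (1 - y 1 / y 2) * (P (y 3) / (1 - y 3 / y 2)) +
      P (y 1) / (1 - y 1 / y 3) * (P (y 2) / (1 - y 2 / y 3))"
  proof -
    define T where "T i m = (\<Prod>j=1..3. 1 - x j * y i) / (1 - y i / y m)" for i m
    have T: "T i m = P (y i) / (1 - y i / y m)" for i m
      unfolding T_def sets(1) by (simp add: P_def)
    have "normalized_integral 3 x y = (\<Sum>m=1..3. \<Prod>i\<in>{1..3} - {m}. T i m)"
      unfolding T_def by (rule normalized_integral_distinct[OF _ x y inj nz]) auto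
    also have "\<dots> = (\<Prod>i\<in>{1, 2, 3} - {1}. T i 1) + (\<Prod>i\<in>{1, 2, 3} - {2}. T i 2) + (\<Prod>i\<in>{1, 2, 3} - {3}. T i 3)"
      unfolding sets(1) by simp
    also have "\<dots> = T 2 1 * T 3 1 + T 1 2 * T 3 2 + T 1 3 * T 2 3"
      unfolding sets by simp
    finally show ?thesis unfolding T .
  qed
  also have "\<dots> = P (y 2) * y 1 / (y 1 - y 2) * (P (y 3) * y 1 / (y 1 - y 3)) +
      P (y 1) * y 2 / (y 2 - y 1) * (P (y 3) * y 2 / (y 2 - y 3)) +
      P (y 1) * y 3 / (y 3 - y 1) * (P (y 2) * y 3 / (y 3 - y 2))"
    using ne ne(1-3)[symmetric] by (simp only: divide_one_minus_divide simp_thms)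
  also have "\<dots> = ((y 1)^2 * (y 2 - y 3) * P (y 2) * P (y 3) - (y 2)^2 * (y 1 - y 3) * P (y 1) * P (y 3)
      + (y 3)^2 * (y 1 - y 2) * P (y 1) * P (y 2)) / ((y 1 - y 2) * (y 1 - y 3) * (y 2 - y 3))"
  proof -
    \<comment> \<open>Here \<open>d1\<close>, \<open>d2\<close>, \<open>d3\<close> stand for
      \<open>y 1 - y 2\<close>, \<open>y 1 - y 3\<close>, \<open>y 2 - y 3\<close>. Reversed
      differences are their negatives, which produces the alternating signs of the
      numerator.\<close>
    have "u * a / d1 * (v * a / d2) + w * b / (- d1) * (v * b / d3) + w * c / (- d2) * (u * c / (- d3)) =
        (a^2 * d3 * u * v - b^2 * d2 * w * v + c^2 * d1 * w * u) / (d1 * d2 * d3)"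
      if d: "d1 \<noteq> 0" "d2 \<noteq> 0" "d3 \<noteq> 0" for u v w a b c d1 d2 d3 :: complex
    proof -
      have "u * a / d1 * (v * a / d2) = a^2 * d3 * u * v / (d1 * d2 * d3)"
        "w * b / (- d1) * (v * b / d3) = - (b^2 * d2 * w * v / (d1 * d2 * d3))"
        "w * c / (- d2) * (u * c / (- d3)) = c^2 * d1 * w * u / (d1 * d2 * d3)"
        using d by (simp_all add: power2_eq_square)
      then show ?thesis by (simp add: add_divide_distrib diff_divide_distrib)
    qed
    from this[of "y 1 - y 2" "y 1 - y 3" "y 2 - y 3" "P (y 2)" "y 1" "P (y 3)" "P (y 1)" "y 2" "y 3"]
    show ?thesis using ne(1-3) by (simp only: right_minus_eq minus_diff_eq not_False_eq_True simp_thms)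
  qed
  also have "\<dots> = cubic_kernel x y"
    unfolding P_def cubic_kernel_def Let_def
      cubic_kernel_Lagrange[where ?x1.0 = "x 1" and ?x2.0 = "x 2" and ?x3.0 = "x 3"
        and ?y1.0 = "y 1" and ?y2.0 = "y 2" and ?y3.0 = "y 3"]
    by (rule nonzero_mult_div_cancel_right) (use ne in simp)
  finally show "normalized_integral 3 x y = cubic_kernel x y" .
qed

text \<open>In the application \<open>A i\<close> and \<open>B i\<close> are \<open>p\<close> to the
  powers \<open>\<alpha> i\<close> and \<open>\<alpha> (3 + i)\<close>, \<open>a i\<close> and
  \<open>b i\<close> are their inverses, \<open>r\<close> is \<open>p powc (- s)\<close>, and
  \<open>g'\<close> is \<open>cnj g\<close>. Every term of the kernel has equal degree in
  \<open>x\<close> and \<open>y\<close>, so \<open>g\<close> cancels and \<open>r\<close> appears to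
  twice that degree. The second elementary symmetric polynomial becomes the third times the sum of
  the reciprocals.\<close>

lemma cubic_kernel_local_factor:
  fixes a A b B x y :: "nat \<Rightarrow> complex"
  assumes a: "\<And>i. A i * a i = 1" and b: "\<And>i. B i * b i = 1" and g: "g * g' = 1"
    and x: "\<And>i. x i = g * (r * a i)" and y: "\<And>i. y i = g' * (r * B i)"
    and D: "D = a 1 * a 2 * a 3 * (B 1 * B 2 * B 3)"
  shows "cubic_kernel x y =
     1 - D * (A 1 + A 2 + A 3) * (b 1 + b 2 + b 3) * r^4
       + D * ((A 1 + A 2 + A 3) * (a 1 + a 2 + a 3) + (B 1 + B 2 + B 3) * (b 1 + b 2 + b 3) - 2) * r^6
       - D * (a 1 + a 2 + a 3) * (B 1 + B 2 + B 3) * r^8 + D^2 * r^12"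
proof -
  define a1 a2 a3 where "a1 = a 1 + a 2 + a 3" and "a2 = a 1 * a 2 + a 1 * a 3 + a 2 * a 3"
    and "a3 = a 1 * a 2 * a 3"
  define b1 b2 b3 where "b1 = B 1 + B 2 + B 3" and "b2 = B 1 * B 2 + B 1 * B 3 + B 2 * B 3"
    and "b3 = B 1 * B 2 * B 3"
  have A: "a3 * (A 1 + A 2 + A 3) = a2"
  proof -
    have "a3 * (A 1 + A 2 + A 3) = A 1 * a 1 * (a 2 * a 3) + A 2 * a 2 * (a 1 * a 3) + A 3 * a 3 * (a 1 * a 2)"
      by (simp add: a3_def algebra_simps)
    then show ?thesis unfolding a by (simp add: a2_def)
  qed
  have b': "b3 * (b 1 + b 2 + b 3) = b2"
  proof -
    have "b3 * (b 1 + b 2 + b 3) = B 1 * b 1 * (B 2 * B 3) + B 2 * b 2 * (B 1 * B 3) + B 3 * b 3 * (B 1 * B 2)"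
      by (simp add: b3_def algebra_simps)
    then show ?thesis unfolding b by (simp add: b2_def)
  qed
  have x': "x 1 + x 2 + x 3 = g * r * a1" "x 1 * x 2 + x 1 * x 3 + x 2 * x 3 = g^2 * r^2 * a2"
    "x 1 * x 2 * x 3 = g^3 * r^3 * a3"
    unfolding x a1_def a2_def a3_def by (simp_all add: algebra_simps power2_eq_square power3_eq_cube)
  have y': "y 1 + y 2 + y 3 = g' * r * b1" "y 1 * y 2 + y 1 * y 3 + y 2 * y 3 = g'^2 * r^2 * b2"
    "y 1 * y 2 * y 3 = g'^3 * r^3 * b3"
    unfolding y b1_def b2_def b3_def by (simp_all add: algebra_simps power2_eq_square power3_eq_cube)
  define sA sb where "sA = A 1 + A 2 + A 3" and "sb = b 1 + b 2 + b 3"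
  have D': "D = a3 * b3" by (simp add: D a3_def b3_def)
  have t1: "g^2 * r^2 * a2 * (g'^2 * r^2 * b2) = D * sA * sb * r^4"
  proof -
    have "g^2 * r^2 * a2 * (g'^2 * r^2 * b2) = (g * g')^2 * (a2 * b2 * r^4)"
      by (simp add: eval_nat_numeral mult_ac)
    also have "\<dots> = a3 * sA * (b3 * sb) * r^4"
      unfolding g A b' sA_def sb_def by simp
    finally show ?thesis unfolding D' by (simp add: mult_ac)
  qed
  have t2: "g * r * a1 * (g^2 * r^2 * a2) * (g'^3 * r^3 * b3) = D * sA * a1 * r^6"
  proof -
    have "g * r * a1 * (g^2 * r^2 * a2) * (g'^3 * r^3 * b3) = (g * g')^3 * (a1 * a2 * b3 * r^6)"
      by (simp add: eval_nat_numeral mult_ac)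
    also have "\<dots> = a1 * (a3 * sA) * b3 * r^6"
      unfolding g A sA_def by simp
    finally show ?thesis unfolding D' by (simp add: mult_ac)
  qed
  have t3: "g^3 * r^3 * a3 * (g' * r * b1) * (g'^2 * r^2 * b2) = D * b1 * sb * r^6"
  proof -
    have "g^3 * r^3 * a3 * (g' * r * b1) * (g'^2 * r^2 * b2) = (g * g')^3 * (a3 * b1 * b2 * r^6)"
      by (simp add: eval_nat_numeral mult_ac)
    also have "\<dots> = a3 * b1 * (b3 * sb) * r^6"
      unfolding g b' sb_def by simp
    finally show ?thesis unfolding D' by (simp add: mult_ac)
  qed
  have t4: "g^3 * r^3 * a3 * (g'^3 * r^3 * b3) = D * r^6"
  proof -
    have "g^3 * r^3 * a3 * (g'^3 * r^3 * b3) = (g * g')^3 * (a3 * b3 * r^6)"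
      by (simp add: eval_nat_numeral mult_ac)
    then show ?thesis unfolding g D' by simp
  qed
  have t5: "D * r^6 * (g * r * a1) * (g' * r * b1) = D * a1 * b1 * r^8"
  proof -
    have "D * r^6 * (g * r * a1) * (g' * r * b1) = (g * g') * (D * a1 * b1 * r^8)"
      by (simp add: eval_nat_numeral mult_ac)
    then show ?thesis unfolding g by simp
  qed
  have "cubic_kernel x y = 1 - D * sA * sb * r^4 + (D * sA * a1 * r^6 + D * b1 * sb * r^6 - 2 * (D * r^6))
      - D * a1 * b1 * r^8 + (D * r^6)^2"
    unfolding cubic_kernel_def Let_def x' y' mult.assoc[of 2] t1 t2 t3 t4 t5 ..
  also have "\<dots> = 1 - D * sA * sb * r^4 + D * (sA * a1 + b1 * sb - 2) * r^6 - D * a1 * b1 * r^8 + D^2 * r^12"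
    by (simp add: algebra_simps power_mult_distrib flip: power_mult)
  finally show ?thesis by (simp only: a1_def b1_def sA_def sb_def)
qed

section \<open>The Euler product of the zeta function\<close>

text \<open>The sieve of Eratosthenes: for a new prime \<open>q\<close>, multiplication by
  \<open>q\<close> maps the surviving integers onto those among them divisible by \<open>q\<close>,
  so removing these multiplies the sum by \<open>1 - f q\<close>.\<close>

lemma infsum_multiplicative_sieve:
  fixes f :: "nat \<Rightarrow> complex"
  assumes mult: "\<And>m n. f (m * n) = f m * f n"
    and summ: "(\<lambda>n. norm (f n)) summable_on {0<..}"
    and P: "finite P" "\<And>p. p \<in> P \<Longrightarrow> prime p"
  shows "infsum f {n. 0 < n \<and> (\<forall>p\<in>P. \<not> p dvd n)} = (\<Prod>p\<in>P. 1 - f p) * infsum f {0<..}"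
  using P
proof (induction P rule: finite_induct)
  case empty
  then show ?case by (simp add: greaterThan_def)
next
  case (insert q P)
  let ?A = "{n. 0 < n \<and> (\<forall>p\<in>P. \<not> p dvd n)}"
  have q: "prime q" "q > 0" using insert by (auto intro: prime_gt_0_nat)
  have summ': "f summable_on B" if "B \<subseteq> {0<..}" for B
    using summable_on_subset_banach[OF abs_summable_summable[OF summ] that] .
  have "infsum f ((\<lambda>n. q * n) ` ?A) = infsum (f \<circ> (\<lambda>n. q * n)) ?A"
    using q by (intro infsum_reindex) (auto simp: inj_on_def)
  also have "\<dots> = f q * infsum f ?A"
    by (simp add: o_def mult infsum_cmult_right')
  finally have im: "infsum f ((\<lambda>n. q * n) ` ?A) = f q * infsum f ?A" .
  have "(\<lambda>n. q * n) ` ?A = {n\<in>?A. q dvd n}"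
  proof (intro equalityI subsetI)
    fix n assume "n \<in> (\<lambda>n. q * n) ` ?A"
    then obtain m where m: "n = q * m" "m \<in> ?A" by auto
    have "\<not> p dvd q * m" if "p \<in> P" for p
    proof
      assume "p dvd q * m"
      moreover have "prime p" using insert that by auto
      ultimately have "p dvd q" using m that by (auto simp: prime_dvd_mult_iff)
      then have "p = q" using \<open>prime p\<close> q by (simp add: primes_dvd_imp_eq)
      then show False using insert that by auto
    qed
    then show "n \<in> {n\<in>?A. q dvd n}" using m q by auto
  next
    fix n assume n: "n \<in> {n\<in>?A. q dvd n}"
    then obtain m where m: "n = q * m" by (auto elim: dvdE)
    with n have "m \<in> ?A" by auto
    with m show "n \<in> (\<lambda>n. q * n) ` ?A" by blast
  qed
  note im_eq = this
  then have "{n. 0 < n \<and> (\<forall>p\<in>insert q P. \<not> p dvd n)} = ?A - (\<lambda>n. q * n) ` ?A"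
    by auto
  moreover have "(\<lambda>n. q * n) ` ?A \<subseteq> ?A" unfolding im_eq by auto
  ultimately have "infsum f {n. 0 < n \<and> (\<forall>p\<in>insert q P. \<not> p dvd n)} =
      infsum f ?A - infsum f ((\<lambda>n. q * n) ` ?A)"
    by (simp only:) (rule infsum_Diff[OF summ' summ'], auto simp: q)
  then show ?case
    using insert im by (simp add: algebra_simps)
qed

text \<open>After sieving by all primes up to \<open>n\<close>, only \<open>1\<close> and integers
  beyond \<open>n\<close> remain, so the sum differs from \<open>f 1\<close> by a tail of an
  absolutely convergent series. The limit \<open>1\<close> also shows that the full sum is
  nonzero.\<close>

lemma Euler_product_LIMSEQ:
  fixes f :: "nat \<Rightarrow> complex"
  assumes mult: "\<And>m n. f (m * n) = f m * f n" and one: "f 1 = 1"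
    and summ: "(\<lambda>n. norm (f n)) summable_on {0<..}"
  shows "(\<lambda>n. (\<Prod>p\<le>n. over_primes (\<lambda>_. True) (\<lambda>p. 1 - f p) p) * infsum f {0<..}) \<longlonglongrightarrow> 1"
proof -
  let ?g = "\<lambda>n. norm (f n)"
  define A where "A n = {m. 0 < m \<and> (\<forall>p\<in>{p. p \<le> n \<and> prime p}. \<not> p dvd m)}" for n :: nat
  have summ': "?g summable_on B" "f summable_on B" if "B \<subseteq> {0<..}" for B
    using summable_on_subset_banach[OF summ that]
      summable_on_subset_banach[OF abs_summable_summable[OF summ] that] by blast+
  have prod: "(\<Prod>p\<le>n. over_primes (\<lambda>_. True) (\<lambda>p. 1 - f p) p) * infsum f {0<..} = infsum f (A n)" for n
  proof -
    have "(\<Prod>p\<le>n. over_primes (\<lambda>_. True) (\<lambda>p. 1 - f p) p) = (\<Prod>p\<in>{p. p \<le> n \<and> prime p}. 1 - f p)"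
      by (rule prod.mono_neutral_cong_right) (auto simp: over_primes_def)
    then show ?thesis
      unfolding A_def by (subst infsum_multiplicative_sieve[OF mult summ]) auto
  qed
  have tail: "infsum ?g {n<..} = infsum ?g {0<..} - sum ?g {0<..n}" for n
  proof -
    have "{n<..} = {0<..} - {0<..n}" by auto
    then show ?thesis
      using infsum_Diff[OF summ'(1) summ'(1), of "{0<..}" "{0<..n}"] by (simp add: subset_iff)
  qed
  have "?g summable_on {0<..}" by (rule summ') simp
  then have "(\<lambda>n. sum ?g {0<..n}) \<longlonglongrightarrow> infsum ?g {0<..}"
  proof -
    \<comment> \<open>The value at \<open>0\<close> is set to \<open>0\<close>, which turns the sum
      over positive integers into a series over all of \<open>nat\<close>.\<close>
    have "((\<lambda>n. if n = 0 then 0 else ?g n) has_sum infsum ?g {0<..}) UNIV"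
      using has_sum_infsum[OF \<open>?g summable_on {0<..}\<close>]
      by (subst has_sum_cong_neutral[where T = "{0<..}" and g = ?g]) auto
    then have "(\<lambda>n. \<Sum>m\<le>n. if m = 0 then 0 else ?g m) \<longlonglongrightarrow> infsum ?g {0<..}"
      using has_sum_imp_sums sums_def_le by blast
    moreover have "(\<Sum>m\<le>n. if m = 0 then 0 else ?g m) = sum ?g {0<..n}" for n
      by (rule sum.mono_neutral_cong_right) auto
    ultimately show ?thesis by simp
  qed
  then have tail0: "(\<lambda>n. infsum ?g {n<..}) \<longlonglongrightarrow> 0"
    using tendsto_diff[OF tendsto_const[of "infsum ?g {0<..}"]] by (subst tail) fastforce
  have "norm (infsum f (A n) - 1) \<le> infsum ?g {n<..}" for n
  proof -
    have 1: "1 \<in> A n" by (auto simp: A_def)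
    have sub: "A n - {1} \<subseteq> {n<..}"
    proof
      fix m assume m: "m \<in> A n - {1}"
      then obtain p where p: "prime p" "p dvd m" using prime_factor_nat by blast
      then have "p \<le> m" using m by (auto simp: A_def intro: dvd_imp_le)
      moreover have "n < p" by (rule ccontr) (use m p in \<open>auto simp: A_def\<close>)
      ultimately show "m \<in> {n<..}" by simp
    qed
    have Apos: "A n \<subseteq> {0<..}" by (auto simp: A_def)
    have "infsum f (A n) - 1 = infsum f (A n - {1})"
      using 1 one infsum_Diff[OF summ'(2)[OF Apos] summ'(2), of "{1}"] by simp
    also have "norm \<dots> \<le> infsum ?g (A n - {1})"
      using Apos by (intro norm_infsum_bound summ'(1)) auto
    also have "\<dots> \<le> infsum ?g {n<..}"
      using sub Apos by (intro infsum_mono2 summ'(1)) auto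
    finally show ?thesis .
  qed
  then have "(\<lambda>n. infsum f (A n) - 1) \<longlonglongrightarrow> 0"
    by (intro Lim_null_comparison[OF _ tail0] always_eventually allI)
  then show ?thesis
    unfolding prod by (rule LIM_zero_cancel)
qed

section \<open>Dirichlet series of powers and the divergence of the sum of
  \<open>1 / p\<close>\<close>

lemma norm_nat_powr: "p > 0 \<Longrightarrow> norm (of_nat p powr z :: complex) = real p powr Re z"
  by (simp add: norm_powr_real_powr)

lemma abs_summable_nat_powr:
  assumes "Re w > 1"
  shows "(\<lambda>n. norm (of_nat n powr (- w) :: complex)) summable_on {0<..}"
proof -
  have "(\<lambda>n. real n powr (- Re w)) summable_on {0<..}"
    using assms by (intro norm_summable_imp_summable_on summable_on_subset_banach[of _ UNIV])
      (auto simp: summable_real_powr_iff intro!: norm_summable_imp_summable_on)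
  then show ?thesis
    by (rule summable_on_cong[THEN iffD1, rotated]) (simp add: norm_nat_powr)
qed

lemma nat_powr_mult: "of_nat (m * n) powr z = of_nat m powr z * (of_nat n powr z :: complex)"
  by (simp add: powr_times_real)

lemma infsum_nat_powr_eq_zeta:
  assumes "Re w > 1"
  shows "infsum (\<lambda>n. of_nat n powr (- w)) {0<..} = zeta w"
proof -
  let ?f = "\<lambda>n. of_nat n powr (- w) :: complex"
  have "(?f has_sum infsum ?f {0<..}) (range Suc)"
    using has_sum_infsum[OF abs_summable_summable[OF abs_summable_nat_powr[OF assms]]]
    unfolding greaterThan_0 .
  then have "(?f \<circ> Suc has_sum infsum ?f {0<..}) UNIV"
    using has_sum_reindex[OF inj_Suc] by blast
  then have "(?f \<circ> Suc) sums infsum ?f {0<..}"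
    by (rule has_sum_imp_sums)
  then show ?thesis
    by (simp add: zeta_def sums_iff o_def powr_minus inverse_eq_divide)
qed

text \<open>If \<open>\<Sum> 1/p\<close> converged, the Euler product would bound \<open>\<zeta>(\<sigma>)\<close>
  uniformly in \<open>\<sigma> > 1\<close>, and \<open>\<sigma> \<rightarrow> 1\<close> would bound the harmonic series.\<close>

lemma not_summable_inverse_primes: "\<not> summable (\<lambda>p. if prime p then 1 / real p else 0)"
proof
  let ?r = "\<lambda>p. if prime p then 1 / real p else 0"
  assume summ: "summable ?r"
  \<comment> \<open>Since
    \<open>1 - p powr (- \<sigma>) \<ge> 1 - 1 / p \<ge> exp (- 2 / p)\<close>, every partial Euler
    product is at least \<open>inverse C\<close>, for all \<open>\<sigma> > 1\<close> at
    once.\<close>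
  define C where "C = exp (2 * suminf ?r)"
  have bound: "(\<Sum>n=1..M. real n powr (- \<sigma>)) \<le> C" if \<sigma>: "\<sigma> > 1" for \<sigma> M
  proof -
    let ?f = "\<lambda>n. of_nat n powr (- of_real \<sigma>) :: complex"
    let ?h = "\<lambda>n. real n powr (- \<sigma>)"
    have f: "?f n = of_real (?h n)" for n
      using powr_of_real[of "real n" "- \<sigma>"] by simp
    have summ\<sigma>: "(\<lambda>n. norm (?f n)) summable_on {0<..}"
      using \<sigma> by (intro abs_summable_nat_powr) simp
    then have hsum: "?h summable_on {0<..}" by (simp add: f)
    define Z where "Z = infsum ?h {0<..}"
    have Z: "infsum ?f {0<..} = of_real Z"
      unfolding f Z_def using infsumI[OF has_sum_of_real[OF has_sum_infsum[OF hsum]]] .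
    have Z0: "Z \<ge> 0" unfolding Z_def by (intro infsum_nonneg) auto
    have "(\<lambda>n. (\<Prod>p\<le>n. over_primes (\<lambda>_. True) (\<lambda>p. 1 - ?f p) p) * infsum ?f {0<..}) \<longlonglongrightarrow> 1"
      using summ\<sigma> by (intro Euler_product_LIMSEQ nat_powr_mult) auto
    moreover have "(\<Prod>p\<le>n. over_primes (\<lambda>_. True) (\<lambda>p. 1 - ?f p) p) =
        of_real (\<Prod>p\<le>n. if prime p then 1 - ?h p else 1)" for n
      unfolding of_real_prod by (intro prod.cong) (auto simp: over_primes_def f)
    ultimately have "(\<lambda>n. complex_of_real ((\<Prod>p\<le>n. if prime p then 1 - ?h p else 1) * Z)) \<longlonglongrightarrow> of_real 1"
      by (simp only: Z of_real_mult of_real_1)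
    then have lim: "(\<lambda>n. (\<Prod>p\<le>n. if prime p then 1 - ?h p else 1) * Z) \<longlonglongrightarrow> 1"
      by (subst (asm) tendsto_of_real_iff)
    have "inverse C * Z \<le> (\<Prod>p\<le>n. if prime p then 1 - ?h p else 1) * Z" for n
    proof (rule mult_right_mono[OF _ Z0])
      have "inverse C \<le> exp (- 2 * (\<Sum>p\<le>n. ?r p))"
        using sum_le_suminf[OF summ, of "{..n}"] by (simp add: C_def flip: exp_minus)
      also have "\<dots> = (\<Prod>p\<le>n. exp (- 2 * ?r p))"
        by (simp only: sum_distrib_left exp_sum finite_atMost)
      also have "\<dots> \<le> (\<Prod>p\<le>n. if prime p then 1 - ?h p else 1)"
      proof (rule prod_mono, safe)
        fix p :: nat
        show "exp (- 2 * ?r p) \<le> (if prime p then 1 - ?h p else 1)"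
        proof (cases "prime p")
          case True
          then have p: "p \<ge> 2" by (rule prime_ge_2_nat)
          have "?h p \<le> real p powr (- 1)"
            using p \<sigma> by (intro powr_mono) auto
          also have "\<dots> = 1 / real p" using p by (simp add: powr_minus inverse_eq_divide)
          finally have "?h p \<le> 1 / real p" .
          moreover have "exp (- 2 * (1 / real p)) \<le> 1 - 1 / real p"
          proof -
            \<comment> \<open>For \<open>0 \<le> x \<le> 1 / 2\<close> one has
              \<open>ln (1 - x) \<ge> - x - 2 * x^2\<close> and \<open>2 * x^2 \<le> x\<close>; a
              prime is at least \<open>2\<close>, so \<open>x = 1 / p\<close> qualifies.\<close>
            have x: "1 / real p \<le> 1 / 2" "0 \<le> 1 / real p" using p by (auto simp: field_simps)
            then have "(1 / real p)\<^sup>2 \<le> 1 / real p * (1 / 2)"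
              unfolding power2_eq_square by (intro mult_left_mono)
            then have "- 2 * (1 / real p) \<le> ln (1 - 1 / real p)"
              using ln_one_minus_pos_lower_bound[OF x(2,1)] by simp
            then show ?thesis
              using x by (subst ln_ge_iff[symmetric]) auto
          qed
          ultimately show ?thesis using True by simp
        qed simp
      qed simp
      finally show "inverse C \<le> (\<Prod>p\<le>n. if prime p then 1 - ?h p else 1)" .
    qed
    then have "inverse C * Z \<le> 1"
      using lim by (intro LIMSEQ_le_const) auto
    then have "Z \<le> C" by (simp add: C_def field_simps)
    moreover have "(\<Sum>n=1..M. ?h n) \<le> Z"
      unfolding Z_def using hsum by (intro finite_sum_le_infsum) auto
    ultimately show ?thesis by linarith
  qed
  have "(\<Sum>n=1..M. 1 / real n) \<le> C" for M
  proof -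
    \<comment> \<open>For fixed \<open>M\<close> the finite sum is continuous in
      \<open>\<sigma>\<close>, so the uniform bound survives the limit
      \<open>\<sigma> \<rightarrow> 1\<close> from the right.\<close>
    have "((\<lambda>\<sigma>. \<Sum>n=1..M. real n powr (- \<sigma>)) \<longlongrightarrow> (\<Sum>n=1..M. real n powr (- 1))) (at_right 1)"
      by (intro tendsto_intros) auto
    moreover have "eventually (\<lambda>\<sigma>. (\<Sum>n=1..M. real n powr (- \<sigma>)) \<le> C) (at_right 1)"
      using bound by (auto intro!: eventually_mono[OF eventually_at_right_less])
    ultimately have "(\<Sum>n=1..M. real n powr (- 1)) \<le> C"
      by (intro tendsto_upperbound) auto
    then show ?thesis by (simp add: powr_minus inverse_eq_divide)
  qed
  note harmonic = this
  have "(\<Sum>n<M. 1 / real (Suc n)) \<le> C" for M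
    using harmonic[of M] sum.atLeast1_atMost_eq[of "\<lambda>n. 1 / real n" M] by (simp del: of_nat_Suc)
  then have "summable (\<lambda>n. 1 / real (Suc n))"
    by (intro summableI_nonneg_bounded) auto
  then have "summable (\<lambda>n. 1 / real n)"
    by (subst (asm) summable_Suc_iff)
  then show False
    using not_summable_harmonic[where 'a=real] by (simp add: inverse_eq_divide)
qed

section \<open>Local factors and their products\<close>

text \<open>Absolute convergence depends only on large indices, and \<open>f\<close> is
  \<open>F\<close> times a correction supported on \<open>S\<close>. The correction is multiplied on
  and never divided by, so \<open>f\<close> may vanish on \<open>S\<close>.\<close>

lemma prodinf_finite_modification:
  fixes f F :: "nat \<Rightarrow> complex"
  assumes conv: "abs_convergent_prod f" and S: "finite S"
    and eq: "\<And>n. n \<notin> S \<Longrightarrow> F n = f n" and one: "\<And>n. n \<in> S \<Longrightarrow> F n = 1"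
  shows "abs_convergent_prod F" "prodinf f = prodinf F * prod f S"
proof -
  obtain m where m: "\<And>n. n \<in> S \<Longrightarrow> n < m" using S finite_nat_set_iff_bounded by auto
  have "eventually (\<lambda>n. norm (F n - 1) = norm (f n - 1)) sequentially"
  proof (rule eventually_sequentiallyI[of m])
    fix n assume "m \<le> n"
    then have "n \<notin> S" using m by force
    then show "norm (F n - 1) = norm (f n - 1)" by (simp add: eq)
  qed
  then show F: "abs_convergent_prod F"
    using conv unfolding abs_convergent_prod_conv_summable by (subst summable_cong)
  have "f = (\<lambda>n. F n * (if n \<in> S then f n else 1))"
    using eq one by (intro ext) auto
  then have "prodinf f = prodinf F * prodinf (\<lambda>n. if n \<in> S then f n else 1)"
    using prodinf_mult[OF abs_convergent_prod_imp_convergent_prod[OF F] convergent_prod_If_finite_set[OF S]]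
    by metis
  also have "prodinf (\<lambda>n. if n \<in> S then f n else 1) = prod f S"
    using has_prod_unique[OF has_prod_If_finite_set[OF S]] by metis
  finally show "prodinf f = prodinf F * prod f S" .
qed

lemma finite_prime_divisors_nat: "N \<ge> 1 \<Longrightarrow> finite {p::nat. prime p \<and> p dvd N}"
  by (rule finite_subset[OF _ finite_divisors_nat[of N]]) auto

lemma A_local_trivial_factor:
  assumes "\<And>x. L p x = 1"
  shows "A_local k L s \<alpha> p = (\<Prod>i=1..k. \<Prod>j=1..k. 1 - 1 / p powc (2 * s + \<alpha> i - \<alpha> (k + j)))"
  by (simp add: A_local_def B_local_def conj_fun_def assms)

text \<open>The common frame of all the formulas: primes dividing \<open>N\<close> split off as a
  finite product, and only the closed form \<open>G\<close> of the remaining local factors changes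
  from case to case.\<close>

lemma A_eq_prodinf:
  assumes N: "N \<ge> 1" and conv: "A_converges k L s \<alpha>"
    and triv: "\<And>p x. prime p \<Longrightarrow> p dvd N \<Longrightarrow> L p x = 1"
    and loc: "\<And>p. prime p \<Longrightarrow> \<not> p dvd N \<Longrightarrow> A_local k L s \<alpha> p = G p"
  defines "F \<equiv> over_primes (\<lambda>p. \<not> p dvd N) G"
  shows "abs_convergent_prod F"
    and "A k L s \<alpha> = prodinf F *
      (\<Prod>p | prime p \<and> p dvd N. \<Prod>i=1..k. \<Prod>j=1..k. 1 - 1 / p powc (2 * s + \<alpha> i - \<alpha> (k + j)))"
proof -
  let ?S = "{p. prime p \<and> p dvd N}" and ?f = "over_primes (\<lambda>_. True) (A_local k L s \<alpha>)"
  note mod = prodinf_finite_modification[where f = ?f and F = F and S = ?S]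
  have eq: "F n = ?f n" if "n \<notin> ?S" for n
    using that loc by (auto simp: F_def over_primes_def)
  have one: "F n = 1" if "n \<in> ?S" for n
    using that by (auto simp: F_def over_primes_def)
  have conv': "abs_convergent_prod ?f" using conv by (simp add: A_converges_def)
  show "abs_convergent_prod F"
    by (rule mod(1)[OF conv' finite_prime_divisors_nat[OF N] eq one])
  have "prod ?f ?S = (\<Prod>p\<in>?S. \<Prod>i=1..k. \<Prod>j=1..k. 1 - 1 / p powc (2 * s + \<alpha> i - \<alpha> (k + j)))"
    by (rule prod.cong) (auto simp: over_primes_def triv A_local_trivial_factor)
  then show "A k L s \<alpha> = prodinf F *
      (\<Prod>p\<in>?S. \<Prod>i=1..k. \<Prod>j=1..k. 1 - 1 / p powc (2 * s + \<alpha> i - \<alpha> (k + j)))"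
    using mod(2)[OF conv' finite_prime_divisors_nat[OF N] eq one] by (simp add: A_def)
qed

lemma norm_inverse_nat_powr_less_one:
  assumes "prime p" "Re z > 0"
  shows "norm (1 / p powc z) < 1"
proof -
  have "real p > 1" using prime_gt_1_nat[OF assms(1)] by simp
  then have "real p powr Re z > 1" using assms(2) by simp
  then show ?thesis using \<open>real p > 1\<close> by (simp add: norm_divide norm_nat_powr)
qed

section \<open>One prime not dividing \<open>N\<close>, with \<open>g\<close> the value of
  \<open>\<gamma>\<close> or of the character there\<close>

locale local_factor =
  fixes k :: nat and L :: "nat \<Rightarrow> complex \<Rightarrow> complex" and s :: complex and \<alpha> :: "nat \<Rightarrow> complex"
    and p :: nat and g :: complex
  assumes p: "prime p" and g: "norm g = 1" and L: "\<And>x. L p x = 1 / (1 - g * x)"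
    and dom: "local_domain k s \<alpha>"
begin

definition x :: "nat \<Rightarrow> complex" where "x j = g / p powc (s + \<alpha> j)"

definition y :: "nat \<Rightarrow> complex" where "y j = cnj g / p powc (s - \<alpha> (k + j))"

lemma local_params_unit: "g * cnj g = 1"
  by (simp add: complex_norm_square[symmetric] g)

lemma nat_p_nonzero: "(of_nat p :: complex) \<noteq> 0" "p powc z \<noteq> 0"
  using p prime_gt_0_nat by auto

lemma norm_local_params:
  assumes "j \<in> {1..k}"
  shows "norm (x j) < 1" "norm (y j) < 1"
  using assms dom g norm_inverse_nat_powr_less_one[OF p, of "s + \<alpha> j"]
    norm_inverse_nat_powr_less_one[OF p, of "s - \<alpha> (k + j)"]
  by (auto simp: x_def y_def local_domain_def norm_divide)

lemma local_params_mult: "x i * y j = 1 / p powc (2 * s + \<alpha> i - \<alpha> (k + j))"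
proof -
  have "2 * s + \<alpha> i - \<alpha> (k + j) = (s + \<alpha> i) + (s - \<alpha> (k + j))" by simp
  then have "p powc (2 * s + \<alpha> i - \<alpha> (k + j)) = p powc (s + \<alpha> i) * p powc (s - \<alpha> (k + j))"
    by (metis powr_add)
  then show ?thesis using local_params_unit by (simp add: x_def y_def)
qed

lemma local_params_ratio: "y i / y j = p powc (\<alpha> (k + i) - \<alpha> (k + j))"
proof -
  have "\<alpha> (k + i) - \<alpha> (k + j) = (s - \<alpha> (k + j)) - (s - \<alpha> (k + i))" by simp
  then have "p powc (\<alpha> (k + i) - \<alpha> (k + j)) = p powc (s - \<alpha> (k + j)) / p powc (s - \<alpha> (k + i))"
    by (metis powr_diff)
  moreover have "cnj g \<noteq> 0" using g by auto
  ultimately show ?thesis by (simp add: y_def)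
qed

lemma A_local_eq_normalized_integral: "A_local k L s \<alpha> p = normalized_integral k x y"
proof -
  have "L p (e \<theta> / p powc (s + \<alpha> j)) = 1 / (1 - x j * e \<theta>)" for \<theta> j
    by (simp add: L x_def)
  moreover have "conj_fun (L p) (e (- \<theta>) / p powc (s - \<alpha> (k + j))) = 1 / (1 - y j * e (- \<theta>))" for \<theta> j
    by (simp add: conj_fun_def L y_def)
  ultimately show ?thesis
    unfolding A_local_def B_local_def normalized_integral_def circle_integral_def local_params_mult by simp
qed

text \<open>By \<open>local_params_ratio\<close> the assumption \<open>ne\<close> says that no
  quotient \<open>y i / y m\<close> with \<open>i \<noteq> m\<close> equals \<open>1\<close>, that
  is, that the \<open>y j\<close> are distinct.\<close>

lemma A_local_distinct:
  assumes k: "k \<ge> 1"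
    and ne: "\<And>m i. m \<in> {1..k} \<Longrightarrow> i \<in> {1..k} - {m} \<Longrightarrow> p powc (\<alpha> (k + i) - \<alpha> (k + m)) \<noteq> 1"
  shows "A_local k L s \<alpha> p = (\<Sum>m=1..k. \<Prod>i\<in>{1..k} - {m}.
      (\<Prod>j=1..k. 1 - 1 / p powc (2 * s + \<alpha> j - \<alpha> (k + i))) / (1 - p powc (\<alpha> (k + i) - \<alpha> (k + m))))"
proof -
  have nz: "y j \<noteq> 0" for j using g nat_p_nonzero by (auto simp: y_def)
  have "inj_on y {1..k}"
  proof (rule inj_onI, rule ccontr)
    fix i m assume "i \<in> {1..k}" "m \<in> {1..k}" "y i = y m" "i \<noteq> m"
    then show False using ne[of m i] local_params_ratio[of i m] nz[of m] by auto
  qed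
  then show ?thesis
    unfolding A_local_eq_normalized_integral local_params_mult[symmetric] local_params_ratio[symmetric]
    by (intro normalized_integral_distinct k norm_local_params nz)
qed

end

lemma A_local_2:
  assumes p: "prime p" and g: "norm g = 1" and L: "\<And>x. L p x = 1 / (1 - g * x)"
    and dom: "local_domain 2 s \<alpha>"
  shows "A_local 2 L s \<alpha> p = 1 - p powc (- (4 * s + \<alpha> 1 + \<alpha> 2 - \<alpha> 3 - \<alpha> 4))"
proof -
  interpret local_factor 2 L s \<alpha> p g by unfold_locales fact+
  have n: "2 + 1 = (3::nat)" "2 + 2 = (4::nat)" by simp_all
  \<comment> \<open>Pairing each \<open>x i\<close> with \<open>y i\<close> makes \<open>g\<close>
    disappear through \<open>local_params_mult\<close>.\<close>
  have "A_local 2 L s \<alpha> p = 1 - (x 1 * y 1) * (x 2 * y 2)"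
    unfolding A_local_eq_normalized_integral
    using normalized_integral_2[OF norm_local_params] by simp
  also have "(x 1 * y 1) * (x 2 * y 2) = p powc (- (2 * s + \<alpha> 1 - \<alpha> (2 + 1))) * p powc (- (2 * s + \<alpha> 2 - \<alpha> (2 + 2)))"
    unfolding local_params_mult powr_minus inverse_eq_divide ..
  also have "\<dots> = p powc (- (4 * s + \<alpha> 1 + \<alpha> 2 - \<alpha> 3 - \<alpha> 4))"
    unfolding powr_add[symmetric] n by (rule arg_cong) (simp add: algebra_simps)
  finally show ?thesis .
qed

lemma A_local_3:
  assumes p: "prime p" and g: "norm g = 1" and L: "\<And>x. L p x = 1 / (1 - g * x)"
    and dom: "local_domain 3 s \<alpha>"
  defines "S \<equiv> (\<Sum>i=1..3. \<alpha> i - \<alpha> (3 + i))"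
  shows "A_local 3 L s \<alpha> p =
    1 - p powc (- S) * (p powc \<alpha> 1 + p powc \<alpha> 2 + p powc \<alpha> 3)
          * (p powc (- \<alpha> 4) + p powc (- \<alpha> 5) + p powc (- \<alpha> 6)) * p powc (- 4 * s)
      + p powc (- S) * ((p powc \<alpha> 1 + p powc \<alpha> 2 + p powc \<alpha> 3)
              * (p powc (- \<alpha> 1) + p powc (- \<alpha> 2) + p powc (- \<alpha> 3))
            + (p powc \<alpha> 4 + p powc \<alpha> 5 + p powc \<alpha> 6)
              * (p powc (- \<alpha> 4) + p powc (- \<alpha> 5) + p powc (- \<alpha> 6)) - 2) * p powc (- 6 * s)
      - p powc (- S) * (p powc (- \<alpha> 1) + p powc (- \<alpha> 2) + p powc (- \<alpha> 3))
          * (p powc \<alpha> 4 + p powc \<alpha> 5 + p powc \<alpha> 6) * p powc (- 8 * s)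
      + p powc (- 2 * S) * p powc (- 12 * s)"
proof -
  interpret local_factor 3 L s \<alpha> p g by unfold_locales fact+
  have p0: "(of_nat p :: complex) \<noteq> 0" using p prime_gt_0_nat by auto
  have pow: "p powc (of_nat n * z) = (p powc z) ^ n" for n z
    using p0 by (simp add: powr_def exp_of_nat_mult mult.assoc)
  have powm: "p powc (- 4 * s) = (p powc (- s)) ^ 4" "p powc (- 6 * s) = (p powc (- s)) ^ 6"
    "p powc (- 8 * s) = (p powc (- s)) ^ 8" "p powc (- 12 * s) = (p powc (- s)) ^ 12"
    "p powc (- 2 * S) = (p powc (- S)) ^ 2"
    using pow[of 4 "- s"] pow[of 6 "- s"] pow[of 8 "- s"] pow[of 12 "- s"] pow[of 2 "- S"] by simp_all
  have inv: "p powc z * p powc (- z) = 1" for z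
    using p0 by (simp add: powr_minus)
  have x: "x i = g * (p powc (- s) * p powc (- \<alpha> i))" for i
    by (simp add: x_def powr_add powr_minus divide_inverse)
  have y: "y i = cnj g * (p powc (- s) * p powc (\<alpha> (3 + i)))" for i
    by (simp add: y_def powr_diff powr_minus divide_inverse mult_ac)
  have S: "- S = - \<alpha> 1 + - \<alpha> 2 + - \<alpha> 3 + (\<alpha> (3 + 1) + \<alpha> (3 + 2) + \<alpha> (3 + 3))"
    by (simp add: S_def eval_nat_numeral)
  have D: "p powc (- S) = p powc (- \<alpha> 1) * p powc (- \<alpha> 2) * p powc (- \<alpha> 3) *
      (p powc (\<alpha> (3 + 1)) * p powc (\<alpha> (3 + 2)) * p powc (\<alpha> (3 + 3)))"
    unfolding S powr_add by simp
  have "A_local 3 L s \<alpha> p = cubic_kernel x y"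
    unfolding A_local_eq_normalized_integral
    by (intro normalized_integral_3 norm_local_params) auto
  also note cubic_kernel_local_factor[OF inv inv local_params_unit x y D]
  finally show ?thesis unfolding powm by simp
qed

text \<open>By Euler's theorem and periodicity, \<open>\<psi> n\<close> is a root of unity of order
  dividing \<open>totient N\<close>.\<close>

lemma norm_dirichlet_character:
  assumes \<psi>: "dirichlet_character N \<psi>" and N: "N \<ge> 1" and n: "coprime n N"
  shows "norm (\<psi> n) = 1"
proof -
  have one: "\<psi> 1 = 1" and mult: "\<And>m n. \<psi> (m * n) = \<psi> m * \<psi> n" and per: "\<And>n. \<psi> (n + N) = \<psi> n"
    using \<psi> by (auto simp: dirichlet_character_def)
  have per': "\<psi> (a + b * N) = \<psi> a" for a b
  proof (induction b)
    case (Suc b)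
    then show ?case using per[of "a + b * N"] by (simp add: algebra_simps)
  qed simp
  have pow: "\<psi> (n ^ m) = \<psi> n ^ m" for m
    by (induction m) (use one mult in auto)
  have "[n ^ totient N = 1] (mod N)" using n by (rule euler_theorem)
  \<comment> \<open>Adding multiples of \<open>N\<close> on both sides avoids subtraction of natural
    numbers; periodicity then removes them.\<close>
  then obtain a b where "1 + a * N = n ^ totient N + b * N"
    unfolding cong_iff_lin_nat by auto
  then have "\<psi> (n ^ totient N) = 1" using per' one by metis
  then have "norm (\<psi> n) ^ totient N = 1" by (simp add: pow norm_power[symmetric])
  moreover have "totient N > 0" using N by simp
  ultimately show ?thesis using power_eq_1_iff[of "norm (\<psi> n)" "totient N"] by simp
qed

text \<open>If \<open>Re w \<le> 1\<close>, then \<open>p powc (- w)\<close> has norm at least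
  \<open>1 / p\<close>, and comparison contradicts the divergence over primes. This places
  \<open>w\<close> where the series defining \<open>zeta\<close> represents the zeta
  function.\<close>

lemma Re_gt_one_if_abs_convergent:
  assumes N: "N \<ge> 1"
    and conv: "abs_convergent_prod (over_primes (\<lambda>p. \<not> p dvd N) (\<lambda>p. 1 - p powc (- w)))"
  shows "Re w > 1"
proof (rule ccontr)
  assume w: "\<not> Re w > 1"
  let ?F = "over_primes (\<lambda>p. \<not> p dvd N) (\<lambda>p. 1 - p powc (- w))"
  have "summable (\<lambda>p. norm (?F p - 1))"
    using conv by (simp add: abs_convergent_prod_conv_summable)
  then have "summable (\<lambda>p. if prime p \<and> \<not> p dvd N then 1 / real p else 0)"
  proof (rule summable_comparison_test[OF exI[of _ 0], OF allI, OF impI, rotated])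
    fix p :: nat
    show "norm (if prime p \<and> \<not> p dvd N then 1 / real p else 0) \<le> norm (?F p - 1)"
    proof (cases "prime p \<and> \<not> p dvd N")
      case True
      then have p: "p \<ge> 2" using prime_ge_2_nat by auto
      have "1 / real p = real p powr (- 1)" using p by (simp add: powr_minus inverse_eq_divide)
      also have "\<dots> \<le> real p powr (- Re w)" using p w by (intro powr_mono) auto
      also have "\<dots> = norm (?F p - 1)" using p True by (simp add: over_primes_def norm_nat_powr)
      finally show ?thesis using True by simp
    qed auto
  qed
  \<comment> \<open>No prime beyond \<open>N\<close> divides \<open>N\<close>, so the two series
    agree from index \<open>Suc N\<close> on.\<close>
  also have "?this \<longleftrightarrow> summable (\<lambda>p. if prime p then 1 / real p else 0)"
    using N by (intro summable_cong eventually_sequentiallyI[of "Suc N"]) (auto dest: dvd_imp_le)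
  finally show False using not_summable_inverse_primes by contradiction
qed

text \<open>The product over all primes is \<open>inverse (zeta w)\<close>, and the finitely many
  factors at primes dividing \<open>N\<close> are divided out. This is the origin of the factors
  \<open>inverse (1 - 1 / p powc w)\<close> in the formula for \<open>k = 2\<close>.\<close>

lemma prodinf_primes_coprime_eq_inverse_zeta:
  assumes N: "N \<ge> 1" and w: "Re w > 1"
  shows "prodinf (over_primes (\<lambda>p. \<not> p dvd N) (\<lambda>p. 1 - p powc (- w))) =
    inverse (zeta w) * (\<Prod>p | prime p \<and> p dvd N. inverse (1 - 1 / p powc w))"
proof -
  let ?S = "{p. prime p \<and> p dvd N}"
  let ?E = "over_primes (\<lambda>_. True) (\<lambda>p. 1 - p powc (- w))"
  let ?F = "over_primes (\<lambda>p. \<not> p dvd N) (\<lambda>p. 1 - p powc (- w))"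
  have E: "abs_convergent_prod ?E"
    unfolding abs_convergent_prod_conv_summable
  proof (rule summable_comparison_test[OF exI[of _ 0], OF allI, OF impI])
    show "summable (\<lambda>n. real n powr (- Re w))" using w by (simp add: summable_real_powr_iff)
    show "norm (norm (?E n - 1)) \<le> real n powr (- Re w)" for n
      by (auto simp: over_primes_def norm_nat_powr prime_gt_0_nat)
  qed
  have "(\<lambda>n. (\<Prod>p\<le>n. ?E p) * zeta w) \<longlonglongrightarrow> 1"
    using Euler_product_LIMSEQ[OF nat_powr_mult _ abs_summable_nat_powr[OF w]]
    by (simp add: infsum_nat_powr_eq_zeta[OF w])
  moreover have "(\<lambda>n. (\<Prod>p\<le>n. ?E p) * zeta w) \<longlonglongrightarrow> prodinf ?E * zeta w"
    by (intro tendsto_mult_right convergent_prod_LIMSEQ abs_convergent_prod_imp_convergent_prod E)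
  ultimately have one: "prodinf ?E * zeta w = 1" using LIMSEQ_unique by blast
  have "prodinf ?E = prodinf ?F * prod ?E ?S"
    by (rule prodinf_finite_modification(2)[OF E finite_prime_divisors_nat[OF N]])
      (auto simp: over_primes_def)
  moreover have "prod ?E ?S = (\<Prod>p\<in>?S. 1 - 1 / p powc w)"
    by (rule prod.cong) (auto simp: over_primes_def powr_minus inverse_eq_divide)
  moreover have "(\<Prod>p\<in>?S. 1 - 1 / p powc w) * (\<Prod>p\<in>?S. inverse (1 - 1 / p powc w)) = 1"
    unfolding prod.distrib[symmetric]
  proof (rule prod.neutral, safe)
    fix p :: nat assume "prime p"
    then have "1 - 1 / p powc w \<noteq> 0"
      using w by (intro one_minus_nonzero norm_inverse_nat_powr_less_one) auto
    then show "(1 - 1 / p powc w) * inverse (1 - 1 / p powc w) = 1" by simp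
  qed
  ultimately have "prodinf ?F = prodinf ?E * (\<Prod>p\<in>?S. inverse (1 - 1 / p powc w))"
    by (simp add: mult.assoc)
  moreover have "prodinf ?E = inverse (zeta w)"
    using one by (metis inverse_unique mult.commute)
  ultimately show ?thesis by simp
qed

theorem corollary2p6p2:
  fixes N :: nat
  assumes "N \<ge> 1"
  shows
    "(\<forall>(k::nat) (L :: nat \<Rightarrow> complex \<Rightarrow> complex) (\<gamma> :: nat \<Rightarrow> complex) (s::complex) (\<alpha> :: nat \<Rightarrow> complex).
        k \<ge> 1 \<longrightarrow>
        (\<forall>p. prime p \<longrightarrow> norm (\<gamma> p) = (if p dvd N then 0 else 1)) \<longrightarrow>
        (\<forall>p x. prime p \<longrightarrow> L p x = 1 / (1 - \<gamma> p * x)) \<longrightarrow>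
        local_domain k s \<alpha> \<longrightarrow>
        A_converges k L s \<alpha> \<longrightarrow>
        (\<forall>p. prime p \<and> \<not> p dvd N \<longrightarrow>
           (\<forall>m\<in>{1..k}. \<forall>i\<in>{1..k} - {m}. p powc (\<alpha> (k + i) - \<alpha> (k + m)) \<noteq> 1)) \<longrightarrow>
        (let F = over_primes (\<lambda>p. \<not> p dvd N) (\<lambda>p.
               \<Sum>m=1..k. \<Prod>i\<in>{1..k} - {m}.
                 (\<Prod>j=1..k. 1 - 1 / p powc (2 * s + \<alpha> j - \<alpha> (k + i)))
                   / (1 - p powc (\<alpha> (k + i) - \<alpha> (k + m))))
         in abs_convergent_prod F \<and>
            A k L s \<alpha> = prodinf F *
              (\<Prod>p | prime p \<and> p dvd N. \<Prod>i=1..k. \<Prod>j=1..k.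
                 1 - 1 / p powc (2 * s + \<alpha> i - \<alpha> (k + j)))))
     \<and>
     (\<forall>(\<psi> :: nat \<Rightarrow> complex) (s::complex) (\<alpha> :: nat \<Rightarrow> complex).
        dirichlet_character N \<psi> \<longrightarrow> conductor N \<psi> = N \<longrightarrow>
        (let L = dirichlet_L_local \<psi> in
          (local_domain 1 s \<alpha> \<longrightarrow>
             A_converges 1 L s \<alpha> \<and>
             A 1 L s \<alpha> = (\<Prod>p | prime p \<and> p dvd N. 1 - 1 / p powc (2 * s + \<alpha> 1 - \<alpha> 2)))
          \<and>
          (local_domain 2 s \<alpha> \<longrightarrow> A_converges 2 L s \<alpha> \<longrightarrow>
             (let w = 4 * s + \<alpha> 1 + \<alpha> 2 - \<alpha> 3 - \<alpha> 4 in
               Re w > 1 \<and>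
               A 2 L s \<alpha> =
                 inverse (zeta w) * (\<Prod>p | prime p \<and> p dvd N. inverse (1 - 1 / p powc w)) *
                 (\<Prod>p | prime p \<and> p dvd N. \<Prod>i=1..2. \<Prod>j=1..2.
                    1 - 1 / p powc (2 * s + \<alpha> i - \<alpha> (2 + j)))))
          \<and>
          (local_domain 3 s \<alpha> \<longrightarrow> A_converges 3 L s \<alpha> \<longrightarrow>
             (let S = (\<Sum>i=1..3. \<alpha> i - \<alpha> (3 + i));
                  F = over_primes (\<lambda>p. \<not> p dvd N) (\<lambda>p.
                    1
                    - p powc (- S)
                        * (p powc \<alpha> 1 + p powc \<alpha> 2 + p powc \<alpha> 3)
                        * (p powc (- \<alpha> 4) + p powc (- \<alpha> 5) + p powc (- \<alpha> 6))
                        * p powc (- 4 * s)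
                    + p powc (- S)
                        * ((p powc \<alpha> 1 + p powc \<alpha> 2 + p powc \<alpha> 3)
                             * (p powc (- \<alpha> 1) + p powc (- \<alpha> 2) + p powc (- \<alpha> 3))
                           + (p powc \<alpha> 4 + p powc \<alpha> 5 + p powc \<alpha> 6)
                             * (p powc (- \<alpha> 4) + p powc (- \<alpha> 5) + p powc (- \<alpha> 6))
                           - 2)
                        * p powc (- 6 * s)
                    - p powc (- S)
                        * (p powc (- \<alpha> 1) + p powc (- \<alpha> 2) + p powc (- \<alpha> 3))
                        * (p powc \<alpha> 4 + p powc \<alpha> 5 + p powc \<alpha> 6)
                        * p powc (- 8 * s)
                    + p powc (- 2 * S) * p powc (- 12 * s))
              in abs_convergent_prod F \<and>
                 A 3 L s \<alpha> = prodinf F *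
                   (\<Prod>p | prime p \<and> p dvd N. \<Prod>i=1..3. \<Prod>j=1..3.
                      1 - 1 / p powc (2 * s + \<alpha> i - \<alpha> (3 + j)))))))"
proof (intro conjI allI impI)
  fix k :: nat and L :: "nat \<Rightarrow> complex \<Rightarrow> complex" and \<gamma> :: "nat \<Rightarrow> complex" and s :: complex
    and \<alpha> :: "nat \<Rightarrow> complex"
  assume k: "k \<ge> 1" and \<gamma>: "\<forall>p. prime p \<longrightarrow> norm (\<gamma> p) = (if p dvd N then 0 else 1)"
    and L: "\<forall>p x. prime p \<longrightarrow> L p x = 1 / (1 - \<gamma> p * x)"
    and dom: "local_domain k s \<alpha>" and conv: "A_converges k L s \<alpha>"
    and ne: "\<forall>p. prime p \<and> \<not> p dvd N \<longrightarrow>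
      (\<forall>m\<in>{1..k}. \<forall>i\<in>{1..k} - {m}. p powc (\<alpha> (k + i) - \<alpha> (k + m)) \<noteq> 1)"
  have triv: "L p x = 1" if "prime p" "p dvd N" for p x
  proof -
    have "norm (\<gamma> p) = 0" using \<gamma> that by simp
    then show ?thesis using L that by simp
  qed
  have loc: "A_local k L s \<alpha> p = (\<Sum>m=1..k. \<Prod>i\<in>{1..k} - {m}.
      (\<Prod>j=1..k. 1 - 1 / p powc (2 * s + \<alpha> j - \<alpha> (k + i))) / (1 - p powc (\<alpha> (k + i) - \<alpha> (k + m))))"
    if "prime p" "\<not> p dvd N" for p
  proof -
    interpret local_factor k L s \<alpha> p "\<gamma> p"
      by unfold_locales (use that \<gamma> L dom in auto)
    show ?thesis
      using that ne by (intro A_local_distinct k) blast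
  qed
  show "let F = over_primes (\<lambda>p. \<not> p dvd N) (\<lambda>p.
               \<Sum>m=1..k. \<Prod>i\<in>{1..k} - {m}.
                 (\<Prod>j=1..k. 1 - 1 / p powc (2 * s + \<alpha> j - \<alpha> (k + i)))
                   / (1 - p powc (\<alpha> (k + i) - \<alpha> (k + m))))
         in abs_convergent_prod F \<and>
            A k L s \<alpha> = prodinf F *
              (\<Prod>p | prime p \<and> p dvd N. \<Prod>i=1..k. \<Prod>j=1..k.
                 1 - 1 / p powc (2 * s + \<alpha> i - \<alpha> (k + j)))"
    unfolding Let_def using A_eq_prodinf[OF assms conv triv loc] by blast
next
  fix \<psi> :: "nat \<Rightarrow> complex" and s :: complex and \<alpha> :: "nat \<Rightarrow> complex"
  assume \<psi>: "dirichlet_character N \<psi>"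
  define L where "L = dirichlet_L_local \<psi>"
  have triv: "L p x = 1" if "prime p" "p dvd N" for p x
  proof -
    have "\<not> coprime p N"
      using that by (metis coprime_absorb_left not_prime_unit)
    then have "\<psi> p = 0" using \<psi> by (simp add: dirichlet_character_def)
    then show ?thesis by (simp add: L_def dirichlet_L_local_def)
  qed
  have norm\<psi>: "norm (\<psi> p) = 1" if "prime p" "\<not> p dvd N" for p
    using that by (intro norm_dirichlet_character[OF \<psi> assms] prime_imp_coprime)
  have L: "L p x = 1 / (1 - \<psi> p * x)" for p x
    by (simp add: L_def dirichlet_L_local_def)
  have A1: "A_converges 1 L s \<alpha> \<and>
      A 1 L s \<alpha> = (\<Prod>p | prime p \<and> p dvd N. 1 - 1 / p powc (2 * s + \<alpha> 1 - \<alpha> 2))"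
    if dom: "local_domain 1 s \<alpha>"
  proof -
    have loc: "A_local 1 L s \<alpha> p = 1" if "prime p" "\<not> p dvd N" for p
    proof -
      interpret local_factor 1 L s \<alpha> p "\<psi> p"
        by unfold_locales (use that norm\<psi> L dom in auto)
      \<comment> \<open>For \<open>k = 1\<close> the sum has the single term \<open>m = 1\<close>,
        which is an empty product.\<close>
      show ?thesis using A_local_distinct by simp
    qed
    \<comment> \<open>Only primes dividing \<open>N\<close> can give a factor different from
      \<open>1\<close>, so for \<open>k = 1\<close> convergence is a conclusion.\<close>
    have "summable (\<lambda>p. norm (over_primes (\<lambda>_. True) (A_local 1 L s \<alpha>) p - 1))"
      by (rule summable_finite[OF finite_prime_divisors_nat[OF assms]]) (auto simp: over_primes_def loc simp del: One_nat_def)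
    then have conv: "A_converges 1 L s \<alpha>"
      by (simp add: A_converges_def abs_convergent_prod_conv_summable)
    have "over_primes (\<lambda>p. \<not> p dvd N) (\<lambda>_. 1) = (\<lambda>_. 1)"
      by (auto simp: over_primes_def)
    then show ?thesis
      using A_eq_prodinf(2)[OF assms conv triv loc] conv by (simp add: numeral_2_eq_2)
  qed
  have A2: "let w = 4 * s + \<alpha> 1 + \<alpha> 2 - \<alpha> 3 - \<alpha> 4 in
               Re w > 1 \<and>
               A 2 L s \<alpha> =
                 inverse (zeta w) * (\<Prod>p | prime p \<and> p dvd N. inverse (1 - 1 / p powc w)) *
                 (\<Prod>p | prime p \<and> p dvd N. \<Prod>i=1..2. \<Prod>j=1..2.
                    1 - 1 / p powc (2 * s + \<alpha> i - \<alpha> (2 + j)))"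
    if dom: "local_domain 2 s \<alpha>" and conv: "A_converges 2 L s \<alpha>"
  proof -
    define w where "w = 4 * s + \<alpha> 1 + \<alpha> 2 - \<alpha> 3 - \<alpha> 4"
    have loc: "A_local 2 L s \<alpha> p = 1 - p powc (- w)" if "prime p" "\<not> p dvd N" for p
      unfolding w_def by (intro A_local_2[where g = "\<psi> p"] that norm\<psi> L dom)
    \<comment> \<open>Splitting off the primes dividing \<open>N\<close> leaves an absolutely
      convergent product of the factors \<open>1 - p powc (- w)\<close>, which determines the
      half-plane of \<open>w\<close> before \<open>zeta w\<close> is evaluated.\<close>
    have "Re w > 1"
      using A_eq_prodinf(1)[OF assms conv triv loc] by (rule Re_gt_one_if_abs_convergent[OF assms])
    then show ?thesis
      using A_eq_prodinf(2)[OF assms conv triv loc]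
      unfolding Let_def w_def[symmetric] prodinf_primes_coprime_eq_inverse_zeta[OF assms \<open>Re w > 1\<close>] by simp
  qed
  note loc3 = A_local_3[where L = L and g = "\<psi> p" and p = p for p, OF _ norm\<psi> L]
  note A3 = A_eq_prodinf[where L = L and k = 3, OF assms _ triv loc3]
  show "let L = dirichlet_L_local \<psi> in
          (local_domain 1 s \<alpha> \<longrightarrow>
             A_converges 1 L s \<alpha> \<and>
             A 1 L s \<alpha> = (\<Prod>p | prime p \<and> p dvd N. 1 - 1 / p powc (2 * s + \<alpha> 1 - \<alpha> 2)))
          \<and>
          (local_domain 2 s \<alpha> \<longrightarrow> A_converges 2 L s \<alpha> \<longrightarrow>
             (let w = 4 * s + \<alpha> 1 + \<alpha> 2 - \<alpha> 3 - \<alpha> 4 in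
               Re w > 1 \<and>
               A 2 L s \<alpha> =
                 inverse (zeta w) * (\<Prod>p | prime p \<and> p dvd N. inverse (1 - 1 / p powc w)) *
                 (\<Prod>p | prime p \<and> p dvd N. \<Prod>i=1..2. \<Prod>j=1..2.
                    1 - 1 / p powc (2 * s + \<alpha> i - \<alpha> (2 + j)))))
          \<and>
          (local_domain 3 s \<alpha> \<longrightarrow> A_converges 3 L s \<alpha> \<longrightarrow>
             (let S = (\<Sum>i=1..3. \<alpha> i - \<alpha> (3 + i));
                  F = over_primes (\<lambda>p. \<not> p dvd N) (\<lambda>p.
                    1
                    - p powc (- S)
                        * (p powc \<alpha> 1 + p powc \<alpha> 2 + p powc \<alpha> 3)
                        * (p powc (- \<alpha> 4) + p powc (- \<alpha> 5) + p powc (- \<alpha> 6))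
                        * p powc (- 4 * s)
                    + p powc (- S)
                        * ((p powc \<alpha> 1 + p powc \<alpha> 2 + p powc \<alpha> 3)
                             * (p powc (- \<alpha> 1) + p powc (- \<alpha> 2) + p powc (- \<alpha> 3))
                           + (p powc \<alpha> 4 + p powc \<alpha> 5 + p powc \<alpha> 6)
                             * (p powc (- \<alpha> 4) + p powc (- \<alpha> 5) + p powc (- \<alpha> 6))
                           - 2)
                        * p powc (- 6 * s)
                    - p powc (- S)
                        * (p powc (- \<alpha> 1) + p powc (- \<alpha> 2) + p powc (- \<alpha> 3))
                        * (p powc \<alpha> 4 + p powc \<alpha> 5 + p powc \<alpha> 6)
                        * p powc (- 8 * s)
                    + p powc (- 2 * S) * p powc (- 12 * s))
              in abs_convergent_prod F \<and>
                 A 3 L s \<alpha> = prodinf F *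
                   (\<Prod>p | prime p \<and> p dvd N. \<Prod>i=1..3. \<Prod>j=1..3.
                      1 - 1 / p powc (2 * s + \<alpha> i - \<alpha> (3 + j)))))"
    unfolding L_def[symmetric] Let_def[of L]
    using A1 A2 A3 unfolding Let_def by blast
qed

end
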